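(* Fix a label set $L$. Consider the category in which the objects are labelled Markov processes $(S,\Sigma,\{\tau_a : a\in L\})$ such that $(S,\Sigma)$ is a separable universally measurable space, and in which the morphisms are zigzag morphisms. In this category every cospan has a semipullback.
   Context: A labelled Markov process (LMP) with label set $L$ is a structure $(S,\Sigma,\{\tau_a : a\in L\})$ where $(S,\Sigma)$ is a measurable space and, for each $a\in L$, $\tau_a\colon S\times\Sigma\to[0,1]$ is a Markov kernel: for each $s\in S$, $\tau_a(s,\cdot)$ is a (countably additive, non-negative) measure with $\tau_a(s,S)\le 1$, and for each $Q\in\Sigma$, $\tau_a(\cdot,Q)$ is $\Sigma$-Borel measurable. A zigzag morphism from $(S,\Sigma,\{\tau_a : a\in L\})$ to $(S',\Sigma',\{\tau'_a : a\in L\})$ is a surjective measurable map $f\colon(S,\Sigma)\to(S',\Sigma')$ such that $\tau_a(s,f^{-1}(Q))=\tau'_a(f(s),Q)$ for all $a\in L$, $s\in S$, $Q\in\Sigma'$. A measurable space $(S,\Sigma)$ is a separable universally measurable space if it is isomorphic (as a measurable space) to a universally measurable subset of a Polish space (separable completely metrizable space), equipped with the trace of the Borel $\sigma$-algebra. A subset of a Polish space $Y$ is universally measurable if it is measurable with respect to the completion of every finite Borel measure on $Y$. A cospan is a pair of morphisms $h_1\colon \mathbf S_1\to \mathbf S_0$, $h_2\colon \mathbf S_2\to \mathbf S_0$ with common codomain. A semipullback of it is an object $\mathbf S_3$ of the category together with morphisms $k_1\colon \mathbf S_3\to \mathbf S_1$, $k_2\colon \mathbf S_3\to \mathbf S_2$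 of the category such that $h_1\circ k_1=h_2\circ k_2$ (no universal property is required). *)

theory Defs
  imports "HOL-Probability.Probability"
begin

section \<open>Separable universally measurable spaces\<close>

definition polish_topology :: "'a topology \<Rightarrow> bool" where
  "polish_topology Y \<longleftrightarrow> separable_space Y \<and> completely_metrizable_space Y"

definition borel_of_topology :: "'a topology \<Rightarrow> 'a measure" where
  "borel_of_topology Y = sigma (topspace Y) {U. openin Y U}"

definition universally_measurable :: "'a topology \<Rightarrow> 'a set \<Rightarrow> bool" where
  "universally_measurable Y A \<longleftrightarrow>
     (\<forall>\<mu>. finite_measure \<mu> \<and> sets \<mu> = sets (borel_of_topology Y) \<longrightarrow> A \<in> sets (completion \<mu>))"

text \<open>The measures carried by the arguments of type \<open>measure\<close> play no role here; only the
  underlying measurable spaces do.\<close>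

definition measurably_isomorphic :: "'a measure \<Rightarrow> 'b measure \<Rightarrow> bool" where
  "measurably_isomorphic M N \<longleftrightarrow>
     (\<exists>f g. f \<in> M \<rightarrow>\<^sub>M N \<and> g \<in> N \<rightarrow>\<^sub>M M \<and>
        (\<forall>x\<in>space M. g (f x) = x) \<and> (\<forall>y\<in>space N. f (g y) = y))"

text \<open>HOL cannot quantify existentially over the type carrying the Polish space. Since a Polish
  space has at most continuum many points, it has a homeomorphic copy whose underlying set is a
  set of reals; \<open>Y\<close> below is an arbitrary Polish topology on an arbitrary set of reals,
  unrelated to the usual topology. The lemma \<open>separable_universally_measurableI\<close> below
  shows that no generality is lost.\<close>

definition separable_universally_measurable :: "'a measure \<Rightarrow> bool" where
  "separable_universally_measurable M \<longleftrightarrow>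
     (\<exists>(Y :: real topology) A. polish_topology Y \<and> universally_measurable Y A \<and>
        measurably_isomorphic M (restrict_space (borel_of_topology Y) A))"

lemma space_borel_of_topology [simp]: "space (borel_of_topology Y) = topspace Y"
  by (simp add: borel_of_topology_def space_measure_of_conv)

lemma borel_of_topology_measurable:
  assumes "continuous_map X Y f"
  shows "f \<in> borel_of_topology X \<rightarrow>\<^sub>M borel_of_topology Y"
  unfolding borel_of_topology_def[of Y]
proof (rule measurable_measure_of)
  show "{U. openin Y U} \<subseteq> Pow (topspace Y)"
    using openin_subset by blast
  show "f \<in> space (borel_of_topology X) \<rightarrow> topspace Y"
    using assms by (simp add: continuous_map_def)
  fix U assume "U \<in> {U. openin Y U}"
  then have "openin X {x \<in> topspace X. f x \<in> U}"
    using assms by (simp add: continuous_map_def)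
  moreover have "f -` U \<inter> space (borel_of_topology X) = {x \<in> topspace X. f x \<in> U}"
    by auto
  ultimately show "f -` U \<inter> space (borel_of_topology X) \<in> sets (borel_of_topology X)"
    using openin_subset by (auto simp: borel_of_topology_def sets_measure_of_conv)
qed

lemma polish_topology_lepoll_real:
  assumes "polish_topology Y"
  shows "topspace Y \<lesssim> (UNIV :: real set)"
proof -
  obtain M d where Md: "Metric_space M d" and Y: "Y = Metric_space.mtopology M d"
    using assms unfolding polish_topology_def completely_metrizable_space_def by blast
  interpret Metric_space M d by (rule Md)
  have top: "topspace Y = M" by (simp add: Y)
  obtain D where D: "countable D" "D \<subseteq> M" "Y closure_of D = M"
    using assms unfolding polish_topology_def separable_space_def top by blast
  define P where "P = D \<times> (UNIV :: nat set)"
  have P: "countable P" using D(1) by (simp add: P_def)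
  define G where "G x = {p \<in> P. d x (fst p) < 1 / real (Suc (snd p))}" for x
  have "inj_on (\<lambda>x. to_nat_on P ` G x) M"
  proof (rule inj_onI, rule ccontr)
    fix x y assume xy: "x \<in> M" "y \<in> M" "to_nat_on P ` G x = to_nat_on P ` G y" "x \<noteq> y"
    have G: "G x = G y"
      using xy(3) inj_on_image_eq_iff[OF inj_on_to_nat_on[OF P], of "G x" "G y"]
      by (auto simp: G_def)
    have "d x y > 0" using xy by simp
    then obtain n where n: "1 / real (Suc n) < d x y / 2"
      using nat_approx_posE[of "d x y / 2"] by auto
    have "x \<in> Y closure_of D" using D(3) xy(1) by simp
    then have "\<forall>r>0. \<exists>c\<in>D. c \<in> mball x r"
      unfolding Y metric_closure_of by blast
    moreover have "1 / real (Suc n) > 0" by simp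
    ultimately obtain c where "c \<in> D" "c \<in> mball x (1 / real (Suc n))" by blast
    then have c: "c \<in> D" "d x c < 1 / real (Suc n)" by (simp_all only: in_mball)
    then have "(c, n) \<in> G x" by (simp add: G_def P_def)
    then have "(c, n) \<in> G y" using G by simp
    then have "d y c < 1 / real (Suc n)" by (simp add: G_def)
    moreover have "d x y \<le> d x c + d y c"
      using triangle[of x c y] commute[of c y] xy c(1) D(2) by auto
    ultimately show False using c(2) n by linarith
  qed
  then have "topspace Y \<lesssim> (UNIV :: nat set set)"
    unfolding lepoll_def top by blast
  then show ?thesis
    using nat_sets_eqpoll_reals lepoll_trans2 by blast
qed

lemma separable_universally_measurableI:
  fixes Y :: "'b topology"
  assumes Y: "polish_topology Y" and A: "universally_measurable Y A"
    and M: "measurably_isomorphic M (restrict_space (borel_of_topology Y) A)"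
  shows "separable_universally_measurable M"
proof -
  obtain e :: "'b \<Rightarrow> real" where e: "inj_on e (topspace Y)"
    using polish_topology_lepoll_real[OF Y] unfolding lepoll_def by blast
  define d where "d = inv_into (topspace Y) e"
  have de: "d (e y) = y" if "y \<in> topspace Y" for y
    using that e by (simp add: d_def)
  define Z where "Z = pullback_topology (e ` topspace Y) d Y"
  have topZ: "topspace Z = e ` topspace Y"
    by (auto simp: Z_def topspace_pullback_topology de)
  have ed: "e (d z) = z" "d z \<in> topspace Y" if "z \<in> topspace Z" for z
    using that by (auto simp: topZ de)
  have cd: "continuous_map Z Y d"
    using continuous_map_pullback[OF continuous_map_id[of Y], of "e ` topspace Y" d]
    by (simp add: Z_def)
  have ce: "continuous_map Y Z e"
    unfolding Z_def
  proof (rule continuous_map_pullback')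
    show "continuous_map Y Y (d \<circ> e)"
      by (rule continuous_map_eq[OF continuous_map_id]) (simp add: de)
    show "topspace Y \<subseteq> e -` e ` topspace Y" by auto
  qed
  have hom: "Y homeomorphic_space Z"
    unfolding homeomorphic_space_def homeomorphic_maps_def
    using cd ce de ed by blast
  have Z: "polish_topology Z"
    using Y hom unfolding polish_topology_def
    by (metis homeomorphic_completely_metrizable_space homeomorphic_separable_space)
  let ?A = "d -` A \<inter> topspace Z"
  have dm: "d \<in> borel_of_topology Z \<rightarrow>\<^sub>M borel_of_topology Y"
    and em: "e \<in> borel_of_topology Y \<rightarrow>\<^sub>M borel_of_topology Z"
    using cd ce by (auto intro: borel_of_topology_measurable)
  have uA: "universally_measurable Z ?A"
    unfolding universally_measurable_def
  proof safe
    fix \<nu> assume fin: "finite_measure \<nu>" and s: "sets \<nu> = sets (borel_of_topology Z)"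
    have sp: "space \<nu> = topspace Z" using sets_eq_imp_space_eq[OF s] by simp
    have dn: "d \<in> \<nu> \<rightarrow>\<^sub>M borel_of_topology Y" using dm s measurable_cong_sets by blast
    let ?\<mu> = "distr \<nu> (borel_of_topology Y) d"
    have "finite_measure ?\<mu>" using finite_measure.finite_measure_distr[OF fin dn] .
    then have "A \<in> sets (completion ?\<mu>)"
      using A by (simp add: universally_measurable_def)
    then obtain S N N' where SN: "A = S \<union> N" "N \<subseteq> N'" "N' \<in> null_sets ?\<mu>" "S \<in> sets ?\<mu>"
      by (rule sets_completionE)
    have "d -` N' \<inter> space \<nu> \<in> null_sets \<nu>"
      using SN(3) dn by (simp add: null_sets_distr_iff)
    moreover have "d -` S \<inter> space \<nu> \<in> sets \<nu>"
      using SN(4) dn by (simp add: measurable_sets)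
    ultimately show "?A \<in> sets (completion \<nu>)"
      by (intro sets_completionI[of _ "d -` S \<inter> space \<nu>" "d -` N \<inter> space \<nu>" "d -` N' \<inter> space \<nu>"])
         (use SN sp in auto)
  qed
  obtain f g where fg: "f \<in> M \<rightarrow>\<^sub>M restrict_space (borel_of_topology Y) A"
      "g \<in> restrict_space (borel_of_topology Y) A \<rightarrow>\<^sub>M M"
      "\<forall>x\<in>space M. g (f x) = x" "\<forall>y\<in>A \<inter> topspace Y. f (g y) = y"
    using M unfolding measurably_isomorphic_def space_restrict_space space_borel_of_topology
    by blast
  have d': "d \<in> restrict_space (borel_of_topology Z) ?A \<rightarrow>\<^sub>M restrict_space (borel_of_topology Y) A"
    by (rule measurable_restrict_space2) (auto intro: measurable_restrict_space1 dm simp: space_restrict_space)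
  have e': "e \<in> restrict_space (borel_of_topology Y) A \<rightarrow>\<^sub>M restrict_space (borel_of_topology Z) ?A"
    by (rule measurable_restrict_space2)
       (auto intro: measurable_restrict_space1 em simp: space_restrict_space de topZ)
  have fA: "f x \<in> A \<and> f x \<in> topspace Y" if "x \<in> space M" for x
    using measurable_space[OF fg(1) that] by (simp add: space_restrict_space)
  have "measurably_isomorphic M (restrict_space (borel_of_topology Z) ?A)"
    unfolding measurably_isomorphic_def
  proof (intro exI conjI ballI)
    show "e \<circ> f \<in> M \<rightarrow>\<^sub>M restrict_space (borel_of_topology Z) ?A"
      using fg(1) e' by (rule measurable_comp)
    show "g \<circ> d \<in> restrict_space (borel_of_topology Z) ?A \<rightarrow>\<^sub>M M"
      using d' fg(2) by (rule measurable_comp)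
  qed (auto simp: space_restrict_space fg de ed fA)
  with Z uA show ?thesis
    unfolding separable_universally_measurable_def by blast
qed


section \<open>Labelled Markov processes and zigzag morphisms\<close>

text \<open>The label set is a set \<open>L\<close> over a type \<open>'l\<close>, so that it may be empty; kernels at
  labels outside \<open>L\<close> and at points outside the state space are irrelevant. Only the
  measurable-space part of \<open>states\<close> matters, not its measure.\<close>

record ('l, 's) lmp =
  states :: "'s measure"
  kernel :: "'l \<Rightarrow> 's \<Rightarrow> 's measure"

text \<open>By \<open>measurable_submarkov\<close>, the condition below says that
  each \<open>kernel S a s\<close> with \<open>s\<close> in the state space is a measure on its \<open>\<sigma>\<close>-algebra of
  total mass at most 1, and that \<open>kernel S a _ Q\<close> is Borel measurable for each measurable
  \<open>Q\<close>. The nonemptiness requirement in \<open>subprob_space\<close> does not exclude the empty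
  process, where the condition is vacuous.\<close>

definition is_lmp :: "'l set \<Rightarrow> ('l, 's) lmp \<Rightarrow> bool" where
  "is_lmp L S \<longleftrightarrow> (\<forall>a\<in>L. kernel S a \<in> states S \<rightarrow>\<^sub>M subprob_algebra (states S))"

definition zigzag :: "'l set \<Rightarrow> ('l, 's) lmp \<Rightarrow> ('l, 't) lmp \<Rightarrow> ('s \<Rightarrow> 't) \<Rightarrow> bool" where
  "zigzag L S T f \<longleftrightarrow>
     f \<in> states S \<rightarrow>\<^sub>M states T \<and> f ` space (states S) = space (states T) \<and>
     (\<forall>a\<in>L. \<forall>s\<in>space (states S). \<forall>Q\<in>sets (states T).
        emeasure (kernel S a s) (f -` Q \<inter> space (states S)) = emeasure (kernel T a (f s)) Q)"


section \<open>The category, its cospans and semipullbacks\<close>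

definition separable_um_lmp :: "'l set \<Rightarrow> ('l, 's) lmp \<Rightarrow> bool" where
  "separable_um_lmp L S \<longleftrightarrow> is_lmp L S \<and> separable_universally_measurable (states S)"

definition cospan ::
  "'l set \<Rightarrow> ('l, 'a) lmp \<Rightarrow> ('l, 'b) lmp \<Rightarrow> ('l, 'c) lmp \<Rightarrow> ('a \<Rightarrow> 'c) \<Rightarrow> ('b \<Rightarrow> 'c) \<Rightarrow> bool" where
  "cospan L S1 S2 S0 h1 h2 \<longleftrightarrow>
     separable_um_lmp L S1 \<and> separable_um_lmp L S2 \<and> separable_um_lmp L S0 \<and> zigzag L S1 S0 h1 \<and> zigzag L S2 S0 h2"

text \<open>Morphisms are functions on state spaces, so \<open>h1 \<circ> k1 = h2 \<circ> k2\<close> is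
  required on the state space of \<open>S3\<close> only.\<close>

definition semipullback ::
  "'l set \<Rightarrow> ('l, 'a) lmp \<Rightarrow> ('l, 'b) lmp \<Rightarrow> ('a \<Rightarrow> 'c) \<Rightarrow> ('b \<Rightarrow> 'c) \<Rightarrow>
   ('l, 'd) lmp \<Rightarrow> ('d \<Rightarrow> 'a) \<Rightarrow> ('d \<Rightarrow> 'b) \<Rightarrow> bool" where
  "semipullback L S1 S2 h1 h2 S3 k1 k2 \<longleftrightarrow>
     separable_um_lmp L S3 \<and> zigzag L S3 S1 k1 \<and> zigzag L S3 S2 k2 \<and>
     (\<forall>s\<in>space (states S3). h1 (k1 s) = h2 (k2 s))"

end

theory Submission
  imports Defs
begin

text \<open>
  The semipullback lives on the set-theoretic pullback with the trace of the product
  \<open>\<sigma>\<close>-algebra. Its kernel at \<open>(s\<^sub>1, s\<^sub>2)\<close> couples \<open>\<mu> = \<tau>\<^sub>1(s\<^sub>1, \<cdot>)\<close> and \<open>\<nu> = \<tau>\<^sub>2(s\<^sub>2, \<cdot>)\<close>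
  conditionally independently over their common image on the base. Conditional
  expectations are avoided: for a sequence of finite partitions of the base separating points,
  the couplings that are conditionally independent given the \<open>n\<close>-th partition assign to a rectangle
  the value \<open>\<Sum>\<^sub>c \<mu>(A \<inter> h\<^sub>1\<^sup>-\<^sup>1 c) \<nu>(B \<inter> h\<^sub>2\<^sup>-\<^sup>1 c) / \<mu>(h\<^sub>1\<^sup>-\<^sup>1 c)\<close>. By polarization these values are
  combinations of sums \<open>\<Sum>\<^sub>c r(c)\<^sup>2 / w(c)\<close>, which increase under refinement and are bounded, so they
  converge for \<^emph>\<open>all\<close> measurable \<open>A\<close>, \<open>B\<close>, and the limit depends measurably on \<open>(s\<^sub>1, s\<^sub>2)\<close>. The
  limiting function of rectangles is countably additive because both marginals are inner
  regular by compact sets (this is where universal measurability enters), so Caratheodory's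
  theorem extends it to a measure. It is concentrated on the pullback since rectangles
  separated by one of the partitions get the limit value 0.
\<close>

section \<open>Embeddings with universally measurable image\<close>

lemma sets_borel_of_euclidean: "sets (borel_of_topology euclidean) = sets borel"
  by (simp only: borel_of_topology_def borel_def topspace_euclidean open_openin[symmetric])

lemma polish_topology_euclidean: "polish_topology (euclidean :: 'x::{second_countable_topology,complete_space} topology)"
proof -
  obtain D :: "'x set" where D: "countable D" "\<And>X. open X \<Longrightarrow> X \<noteq> {} \<Longrightarrow> \<exists>d\<in>D. d \<in> X"
    using countable_dense_setE by blast
  have "- closure D = {}"
    using D(2)[of "- closure D"] closure_subset[of D] by auto
  then have "closure D = UNIV" by blast
  then have "euclidean closure_of D = topspace euclidean" by simp
  then show ?thesis
    using D(1) unfolding polish_topology_def separable_space_def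
    by (intro conjI completely_metrizable_space_euclidean exI[of _ D]) simp_all
qed

text \<open>A set of the completion is a measurable set together with part of a null set, and
  preimages of null sets of the image measure are null. This transports universal measurability
  backwards along measurable maps.\<close>

lemma vimage_completion:
  assumes f: "f \<in> M \<rightarrow>\<^sub>M N" and A: "A \<in> sets (completion (distr M N f))"
  shows "f -` A \<inter> space M \<in> sets (completion M)"
proof -
  obtain S T T' where S: "A = S \<union> T" "T \<subseteq> T'" "T' \<in> null_sets (distr M N f)" "S \<in> sets (distr M N f)"
    using A by (rule sets_completionE)
  show ?thesis
  proof (rule sets_completionI)
    show "f -` T' \<inter> space M \<in> null_sets M"
      using S(3) f by (simp add: null_sets_distr_iff)
    show "f -` S \<inter> space M \<in> sets M"
      using S(4) f by (simp add: measurable_sets)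
    show "f -` A \<inter> space M = (f -` S \<inter> space M) \<union> (f -` T \<inter> space M)"
      "f -` T \<inter> space M \<subseteq> f -` T' \<inter> space M"
      using S by auto
  qed
qed

text \<open>As \<open>G\<close> is measurable, measurable sets and null sets of the trace on
  \<open>G\<close> are measurable sets and null sets of \<open>M\<close>, so the sandwich defining
  the completion carries over.\<close>

lemma completion_restrict_space:
  assumes G: "G \<in> sets M" and A: "A \<in> sets (completion (restrict_space M G))"
  shows "A \<in> sets (completion M)"
proof -
  obtain S T T' where S: "A = S \<union> T" "T \<subseteq> T'" "T' \<in> null_sets (restrict_space M G)"
      "S \<in> sets (restrict_space M G)"
    using A by (rule sets_completionE)
  then show ?thesis
    using G by (intro sets_completionI[of _ S T T']) (auto simp: null_sets_restrict_space sets_restrict_space_iff)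
qed

text \<open>Such an \<open>i\<close> is an isomorphism onto its image with the trace Borel
  \<sigma>-algebra: the third conjunct makes the inverse measurable. The target is a type that is
  itself a Polish space, so that regularity theorems for Borel measures apply directly.\<close>

definition um_embedding :: "'a measure \<Rightarrow> ('a \<Rightarrow> 'x::{second_countable_topology,complete_space}) \<Rightarrow> bool" where
  "um_embedding M i \<longleftrightarrow> i \<in> M \<rightarrow>\<^sub>M borel \<and> inj_on i (space M) \<and>
     (\<forall>A\<in>sets M. \<exists>B\<in>sets borel. A = i -` B \<inter> space M) \<and>
     universally_measurable euclidean (i ` space M)"

text \<open>The inverse of \<open>i\<close> on its image is measurable because every
  \<open>A\<close> in \<open>sets M\<close> is the preimage of a Borel set \<open>B\<close>, and the
  inverse pulls \<open>A\<close> back to the trace of \<open>B\<close>.\<close>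

lemma um_embedding_imp_separable:
  fixes i :: "'a \<Rightarrow> 'x::{second_countable_topology,complete_space}"
  assumes "um_embedding M i"
  shows "separable_universally_measurable M"
proof (rule separable_universally_measurableI)
  show "polish_topology (euclidean :: 'x topology)" by (rule polish_topology_euclidean)
  show "universally_measurable euclidean (i ` space M)"
    using assms by (simp add: um_embedding_def)
  let ?g = "inv_into (space M) i"
  have i: "i \<in> M \<rightarrow>\<^sub>M borel" "inj_on i (space M)"
    and s: "\<And>A. A \<in> sets M \<Longrightarrow> \<exists>B\<in>sets borel. A = i -` B \<inter> space M"
    using assms by (auto simp: um_embedding_def)
  have i': "i \<in> M \<rightarrow>\<^sub>M borel_of_topology euclidean"
    using i(1) measurable_cong_sets[OF refl sets_borel_of_euclidean] by blast
  show "measurably_isomorphic M (restrict_space (borel_of_topology euclidean) (i ` space M))"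
    unfolding measurably_isomorphic_def
  proof (intro exI conjI ballI)
    show "i \<in> M \<rightarrow>\<^sub>M restrict_space (borel_of_topology euclidean) (i ` space M)"
      by (rule measurable_restrict_space2) (use i' in auto)
    show "?g \<in> restrict_space (borel_of_topology euclidean) (i ` space M) \<rightarrow>\<^sub>M M"
    proof (rule measurableI)
      fix A assume A: "A \<in> sets M"
      then obtain B where B: "B \<in> sets borel" "A = i -` B \<inter> space M" using s by blast
      have "?g -` A \<inter> i ` space M = i ` space M \<inter> B"
        using B(2) i(2) by auto
      then show "?g -` A \<inter> space (restrict_space (borel_of_topology euclidean) (i ` space M))
          \<in> sets (restrict_space (borel_of_topology euclidean) (i ` space M))"
        using B(1) by (auto simp: space_restrict_space sets_restrict_space sets_borel_of_euclidean)
    qed (auto simp: space_restrict_space inv_into_into)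
  qed (use i in \<open>auto simp: space_restrict_space f_inv_into_f\<close>)
qed

section \<open>Polish spaces as Borel sets of real sequences\<close>

text \<open>The distances to the points of a dense sequence serve as coordinates and give a
  homeomorphism onto the image. The image is completely metrizable, hence a countable intersection
  of open sets in the space of sequences, hence Borel.\<close>

lemma polish_topology_embedding:
  fixes Y :: "'a topology"
  assumes "polish_topology Y"
  obtains e :: "'a \<Rightarrow> nat \<Rightarrow> real" where
    "homeomorphic_map Y (top_of_set (e ` topspace Y)) e" "e ` topspace Y \<in> sets borel"
proof -
  obtain M d where Md: "Metric_space M d" and Y: "Y = Metric_space.mtopology M d"
    using assms unfolding polish_topology_def completely_metrizable_space_def by blast
  interpret Metric_space M d by (rule Md)
  have top: "topspace Y = M" by (simp add: Y)
  obtain D where D: "countable D" "D \<subseteq> M" "Y closure_of D = M"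
    using assms unfolding polish_topology_def separable_space_def top by blast
  define e where "e y = (\<lambda>n. d y (from_nat_into D n))" for y
  \<comment> \<open>A point \<open>y\<close> of \<open>M\<close> forces \<open>D\<close> to be
    nonempty, so \<open>from_nat_into D\<close> takes its values in \<open>D\<close> and not at a
    default.\<close>
  have close: "\<exists>n. d y (from_nat_into D n) < r" and inD: "from_nat_into D n \<in> M"
    if "y \<in> M" "r > 0" for y r n
  proof -
    have "y \<in> Y closure_of D" using D(3) that by simp
    then have "\<exists>c\<in>D. c \<in> mball y r"
      unfolding Y metric_closure_of using that by blast
    then obtain c where c: "c \<in> D" "d y c < r" by auto
    then show "\<exists>n. d y (from_nat_into D n) < r"
      by (metis D(1) from_nat_into_surj)
    show "from_nat_into D n \<in> M"
      using c(1) D(2) from_nat_into[of D n] by blast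
  qed
  \<comment> \<open>One coordinate suffices: for a dense point within \<open>r/2\<close> of
    \<open>y\<close>, the condition \<open>f n < r/2\<close> puts \<open>y'\<close> within
    \<open>r/2\<close> of that same point.\<close>
  have ball: "\<exists>V. open V \<and> e y \<in> V \<and> (\<forall>y'\<in>M. e y' \<in> V \<longrightarrow> d y y' < r)" if y: "y \<in> M" "r > 0" for y r
  proof -
    obtain n where n: "d y (from_nat_into D n) < r/2"
      using close[of y "r/2"] y by auto
    have "open {f :: nat \<Rightarrow> real. f n < r/2}"
      by (intro open_Collect_less continuous_intros continuous_on_product_coordinates) 
    moreover have "e y \<in> {f. f n < r/2}" using n by (simp add: e_def)
    moreover have "d y y' < r" if y': "y' \<in> M" "e y' \<in> {f. f n < r/2}" for y'
      using triangle[of y "from_nat_into D n" y'] y' y(1) n inD[OF y] commute[of "from_nat_into D n" y']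
      by (auto simp: e_def)
    ultimately show ?thesis by blast
  qed
  have cont: "continuous_map Y euclidean e"
  proof -
    have "continuous_map Y euclideanreal (\<lambda>y. e y n)" for n
      unfolding continuous_map_def top
    proof safe
      fix U :: "real set" assume "openin euclidean U"
      then have U: "open U" by simp
      show "openin Y {y \<in> M. e y n \<in> U}"
        unfolding Y openin_mtopology
      proof safe
        fix y assume y: "y \<in> M" "e y n \<in> U"
        obtain r where r: "r > 0" "ball (e y n) r \<subseteq> U" using U y(2) openE by blast
        have "mball y r \<subseteq> {y \<in> M. e y n \<in> U}"
        proof safe
          fix z assume "z \<in> mball y r"
          then have z: "z \<in> M" "d y z < r" by auto
          then have "\<bar>e y n - e z n\<bar> < r"
            using triangle[of y z "from_nat_into D n"] triangle[of z y "from_nat_into D n"]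
              y(1) inD[OF y(1) r(1)] commute[of y z] by (auto simp: e_def)
          then show "e z n \<in> U" using r(2) by (auto simp: dist_real_def)
        qed auto
        then show "\<exists>r>0. mball y r \<subseteq> {y \<in> M. e y n \<in> U}" using r(1) by blast
      qed
    qed auto
    then show ?thesis
      by (simp add: continuous_map_componentwise_UNIV flip: euclidean_product_topology)
  qed
  have inj: "inj_on e M"
  proof (rule inj_onI, rule ccontr)
    fix x y assume xy: "x \<in> M" "y \<in> M" "e x = e y" "x \<noteq> y"
    then have "d x y > 0" by simp
    with ball[OF xy(1) this] xy show False by force
  qed
  have op: "openin (top_of_set (e ` M)) (e ` U)" if U: "openin Y U" for U
  proof (subst openin_subopen, safe)
    fix y assume y: "y \<in> U"
    have UM: "U \<subseteq> M" "\<exists>r>0. mball y r \<subseteq> U" using U y by (auto simp: Y openin_mtopology)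
    then obtain r where r: "r > 0" "mball y r \<subseteq> U" by blast
    obtain V where V: "open V" "e y \<in> V" "\<forall>y'\<in>M. e y' \<in> V \<longrightarrow> d y y' < r"
      using ball[of y r] r(1) y UM(1) by blast
    have "e ` M \<inter> V \<subseteq> e ` U"
    proof
      fix z assume "z \<in> e ` M \<inter> V"
      then obtain y' where y': "y' \<in> M" "z = e y'" "e y' \<in> V" by blast
      then have "y' \<in> mball y r" using V(3) y UM(1) by auto
      then show "z \<in> e ` U" using r(2) y'(2) by blast
    qed
    moreover have "openin (top_of_set (e ` M)) (e ` M \<inter> V)" using V(1) by (rule openin_open_Int)
    ultimately show "\<exists>T. openin (top_of_set (e ` M)) T \<and> e y \<in> T \<and> T \<subseteq> e ` U"
      using V(2) y UM(1) by blast
  qed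
  have hom: "homeomorphic_map Y (top_of_set (e ` M)) e"
  proof (rule bijective_open_imp_homeomorphic_map)
    show "continuous_map Y (top_of_set (e ` M)) e"
      using cont by (simp add: continuous_map_in_subtopology top)
    show "open_map Y (top_of_set (e ` M)) e"
      using op by (simp add: open_map_def)
  qed (use inj top in auto)
  then have "Y homeomorphic_space top_of_set (e ` M)"
    using homeomorphic_map_imp_homeomorphic_space by blast
  then have "completely_metrizable_space (top_of_set (e ` M))"
    using assms homeomorphic_completely_metrizable_space polish_topology_def by blast
  then have "gdelta_in euclidean (e ` M)"
    using completely_metrizable_space_eq_gdelta_in[OF completely_metrizable_space_euclidean] by auto
  then obtain \<U> where \<U>: "countable \<U>" "\<U> \<subseteq> Collect open" "\<Inter>\<U> = e ` M"
    by (auto simp: gdelta_in_alt intersection_of_def)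
  have "\<Inter>\<U> \<in> sets borel"
  proof (cases "\<U> = {}")
    case False
    have "(\<Inter>U\<in>\<U>. U) \<in> sets borel"
      using \<U>(1,2) False by (intro sets.countable_INT') auto
    then show ?thesis by simp
  qed simp
  with \<U>(3) have "e ` M \<in> sets borel" by simp
  with hom that top show ?thesis by blast
qed

text \<open>The isomorphism onto \<open>A\<close> is composed with an embedding of the Polish space
  as a Borel set of sequences. A finite Borel measure on sequences is restricted to that Borel set
  and moved to \<open>Y\<close>, where the completion contains \<open>A\<close>;
  \<open>vimage_completion\<close> and \<open>completion_restrict_space\<close> lead back.\<close>

lemma separable_imp_um_embedding:
  fixes M :: "'a measure"
  assumes "separable_universally_measurable M"
  obtains i :: "'a \<Rightarrow> nat \<Rightarrow> real" where "um_embedding M i"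
proof -
  obtain Y :: "real topology" and A where Y: "polish_topology Y" and A: "universally_measurable Y A"
    and "measurably_isomorphic M (restrict_space (borel_of_topology Y) A)"
    using assms unfolding separable_universally_measurable_def by blast
  then obtain f g where f: "f \<in> M \<rightarrow>\<^sub>M restrict_space (borel_of_topology Y) A"
    and g: "g \<in> restrict_space (borel_of_topology Y) A \<rightarrow>\<^sub>M M"
    and gf: "\<And>x. x \<in> space M \<Longrightarrow> g (f x) = x" and fg: "\<And>y. y \<in> A \<inter> topspace Y \<Longrightarrow> f (g y) = y"
    unfolding measurably_isomorphic_def space_restrict_space space_borel_of_topology by blast
  obtain e :: "real \<Rightarrow> nat \<Rightarrow> real" where
    hom: "homeomorphic_map Y (top_of_set (e ` topspace Y)) e" and G: "e ` topspace Y \<in> sets borel" (is "?G \<in> _")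
    using polish_topology_embedding[OF Y] by blast
  obtain e' where e': "homeomorphic_maps Y (top_of_set ?G) e e'"
    using hom homeomorphic_map_maps by blast
  have e'e: "e' (e y) = y" if "y \<in> topspace Y" for y
    using e' that by (simp add: homeomorphic_maps_def)
  have ce: "continuous_map Y euclidean e"
    using e' by (simp add: homeomorphic_maps_def continuous_map_in_subtopology)
  have ce': "continuous_map (top_of_set ?G) Y e'"
    using e' by (simp add: homeomorphic_maps_def)
  have em: "e \<in> borel_of_topology Y \<rightarrow>\<^sub>M borel"
    using borel_of_topology_measurable[OF ce] measurable_cong_sets[OF refl sets_borel_of_euclidean] by blast
  have e'm: "e' \<in> restrict_space borel ?G \<rightarrow>\<^sub>M borel_of_topology Y"
    unfolding borel_of_topology_def
  proof (rule measurable_measure_of)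
    fix U assume "U \<in> {U. openin Y U}"
    then have "openin (top_of_set ?G) {x \<in> ?G. e' x \<in> U}"
      using ce' by (simp add: continuous_map_def)
    then obtain V where "open V" "{x \<in> ?G. e' x \<in> U} = ?G \<inter> V"
      by (auto simp: openin_open)
    moreover have "e' -` U \<inter> space (restrict_space borel ?G) = {x \<in> ?G. e' x \<in> U}"
      by (auto simp: space_restrict_space)
    ultimately show "e' -` U \<inter> space (restrict_space borel ?G) \<in> sets (restrict_space borel ?G)"
      by (auto simp: sets_restrict_space)
  next
    show "{U. openin Y U} \<subseteq> Pow (topspace Y)" by (auto dest: openin_subset)
  qed (auto simp: space_restrict_space e'e)
  have f': "f \<in> M \<rightarrow>\<^sub>M borel_of_topology Y" "\<And>x. x \<in> space M \<Longrightarrow> f x \<in> A \<inter> topspace Y"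
    using f measurable_space[OF f] by (auto simp: measurable_restrict_space2_iff space_restrict_space)
  have "um_embedding M (e \<circ> f)"
    unfolding um_embedding_def
  proof (intro conjI ballI)
    show "e \<circ> f \<in> M \<rightarrow>\<^sub>M borel" using f'(1) em by (rule measurable_comp)
    show "inj_on (e \<circ> f) (space M)"
      by (rule inj_on_inverseI[of _ "g \<circ> e'"]) (use f'(2) e'e gf in auto)
  next
    fix S assume S: "S \<in> sets M"
    have "g -` S \<inter> space (restrict_space (borel_of_topology Y) A) \<in> sets (restrict_space (borel_of_topology Y) A)"
      using measurable_sets[OF g S] .
    then obtain T where T: "T \<in> sets (borel_of_topology Y)" "g -` S \<inter> (A \<inter> topspace Y) = A \<inter> T"
      by (auto simp: sets_restrict_space space_restrict_space)
    \<comment> \<open>The witness is the preimage of \<open>T\<close> under \<open>e'\<close> inside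
      \<open>?G\<close>; it is Borel in the whole sequence space because \<open>?G\<close>
      is.\<close>
    show "\<exists>B\<in>sets borel. S = (e \<circ> f) -` B \<inter> space M"
    proof (intro bexI)
      have "e' -` T \<inter> ?G \<in> sets (restrict_space borel ?G)"
        using measurable_sets[OF e'm T(1)] by (simp add: space_restrict_space)
      then show "e' -` T \<inter> ?G \<in> sets borel"
        using G by (simp add: sets_restrict_space_iff)
      have "x \<in> S \<longleftrightarrow> f x \<in> T" if "x \<in> space M" for x
        using T(2) f'(2)[OF that] gf[OF that] by (metis IntD1 IntD2 IntI vimageD vimageI)
      then show "S = (e \<circ> f) -` (e' -` T \<inter> ?G) \<inter> space M"
        using sets.sets_into_space[OF S] f'(2) by (auto simp: e'e)
    qed
  next
    show "universally_measurable euclidean ((e \<circ> f) ` space M)"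
      unfolding universally_measurable_def sets_borel_of_euclidean
    proof safe
      fix \<nu> :: "(nat \<Rightarrow> real) measure" assume fin: "finite_measure \<nu>" and s: "sets \<nu> = sets borel"
      let ?\<nu> = "restrict_space \<nu> ?G"
      have G\<nu>: "?G \<in> sets \<nu>" using G s by simp
      have fin': "finite_measure ?\<nu>"
        using fin G\<nu> by (simp add: finite_measure_restrict_space)
      have e\<nu>: "e' \<in> ?\<nu> \<rightarrow>\<^sub>M borel_of_topology Y"
        using e'm measurable_cong_sets[OF sets_restrict_space_cong[OF s] refl] by blast
      have "A \<in> sets (completion (distr ?\<nu> (borel_of_topology Y) e'))"
        using A finite_measure.finite_measure_distr[OF fin' e\<nu>] by (simp add: universally_measurable_def)
      from vimage_completion[OF e\<nu> this]
      have "e' -` A \<inter> space ?\<nu> \<in> sets (completion \<nu>)"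
        using completion_restrict_space[OF G\<nu>] by blast
      moreover have "e' -` A \<inter> space ?\<nu> = (e \<circ> f) ` space M"
      proof -
        have "space \<nu> = UNIV" using sets_eq_imp_space_eq[OF s] by simp
        moreover have "y \<in> f ` space M" if "y \<in> A" "y \<in> topspace Y" for y
        proof
          show "y = f (g y)" using fg that by simp
          show "g y \<in> space M" using that measurable_space[OF g, of y] by (simp add: space_restrict_space)
        qed
        ultimately show ?thesis
          using f'(2) by (auto simp: space_restrict_space e'e image_image[of e f, symmetric] comp_def)
      qed
      ultimately show "(e \<circ> f) ` space M \<in> sets (completion \<nu>)" by simp
    qed
  qed
  with that show ?thesis .
qed

section \<open>Products of embedded spaces\<close>

text \<open>Sets of this form are closed under complements and countable unions and include the
  rectangles, since by second countability a product of Borel sets is Borel in the product.\<close>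

lemma pair_vimage_borel:
  fixes i :: "'a \<Rightarrow> 'x::{second_countable_topology,complete_space}" and j :: "'b \<Rightarrow> 'y::{second_countable_topology,complete_space}"
  assumes i: "\<And>A. A \<in> sets M \<Longrightarrow> \<exists>B\<in>sets borel. A = i -` B \<inter> space M"
    and j: "\<And>A. A \<in> sets N \<Longrightarrow> \<exists>B\<in>sets borel. A = j -` B \<inter> space N"
    and E: "E \<in> sets (M \<Otimes>\<^sub>M N)"
  shows "\<exists>B\<in>sets borel. E = map_prod i j -` B \<inter> space (M \<Otimes>\<^sub>M N)"
  using E unfolding sets_pair_measure
proof (induction rule: sigma_sets.induct)
  case (Basic E)
  then obtain A A' where A: "E = A \<times> A'" "A \<in> sets M" "A' \<in> sets N" by blast
  then obtain B B' where B: "B \<in> sets borel" "A = i -` B \<inter> space M" "B' \<in> sets borel" "A' = j -` B' \<inter> space N"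
    using i j by metis
  have "B \<times> B' \<in> sets (borel \<Otimes>\<^sub>M borel)" using B by simp
  then have "B \<times> B' \<in> sets borel" by (simp only: borel_prod)
  moreover have "E = map_prod i j -` (B \<times> B') \<inter> space (M \<Otimes>\<^sub>M N)"
    using A(1) B(2,4) by (auto simp: space_pair_measure)
  ultimately show ?case by blast
next
  case (Compl E)
  then obtain B where B: "B \<in> sets borel" "E = map_prod i j -` B \<inter> space (M \<Otimes>\<^sub>M N)" by blast
  show ?case
  proof
    show "- B \<in> sets borel" using B(1) by simp
    show "space M \<times> space N - E = map_prod i j -` (- B) \<inter> space (M \<Otimes>\<^sub>M N)"
      using B(2) by (auto simp: space_pair_measure)
  qed
next
  case (Union E)
  then obtain B where B: "\<And>n :: nat. B n \<in> sets borel" "\<And>n. E n = map_prod i j -` B n \<inter> space (M \<Otimes>\<^sub>M N)"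
    by metis
  show ?case
  proof
    show "(\<Union>n. B n) \<in> sets borel" using B(1) by blast
    show "(\<Union>n. E n) = map_prod i j -` (\<Union>n. B n) \<inter> space (M \<Otimes>\<^sub>M N)"
      using B(2) by auto
  qed
qed (auto intro: bexI[of _ "{}"])

text \<open>A finite measure on the source is pushed forward along \<open>f\<close>, tested against
  \<open>A\<close> there, and the result is pulled back by \<open>vimage_completion\<close>.\<close>

lemma universally_measurable_vimage:
  fixes f :: "'x::topological_space \<Rightarrow> 'y::topological_space"
  assumes A: "universally_measurable euclidean A" and f: "f \<in> borel_measurable borel"
  shows "universally_measurable euclidean (f -` A)"
  unfolding universally_measurable_def sets_borel_of_euclidean
proof safe
  fix \<nu> :: "'x measure" assume fin: "finite_measure \<nu>" and s: "sets \<nu> = sets borel"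
  have f': "f \<in> borel_measurable \<nu>" using f measurable_cong_sets[OF s refl] by blast
  have "A \<in> sets (completion (distr \<nu> borel f))"
    using A finite_measure.finite_measure_distr[OF fin f']
    by (simp add: universally_measurable_def sets_borel_of_euclidean)
  from vimage_completion[OF f' this] show "f -` A \<in> sets (completion \<nu>)"
    using sets_eq_imp_space_eq[OF s] by simp
qed

lemma universally_measurable_Int:
  assumes "universally_measurable Y A" "universally_measurable Y B"
  shows "universally_measurable Y (A \<inter> B)"
  using assms unfolding universally_measurable_def by (blast intro: sets.Int)

lemma universally_measurable_borel:
  "A \<in> sets borel \<Longrightarrow> universally_measurable euclidean A"
  unfolding universally_measurable_def sets_borel_of_euclidean by (blast intro: sets_completionI_sets)

text \<open>The image of \<open>D\<close> is the intersection of a Borel set with the product of the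
  two images, and this product is an intersection of preimages of universally measurable sets under
  the projections. With \<open>D\<close> the pullback, this keeps the constructed process in the
  category.\<close>

lemma um_embedding_pair:
  fixes i :: "'a \<Rightarrow> 'x::{second_countable_topology,complete_space}" and j :: "'b \<Rightarrow> 'y::{second_countable_topology,complete_space}"
  assumes M: "um_embedding M i" and N: "um_embedding N j" and D: "D \<in> sets (M \<Otimes>\<^sub>M N)"
  shows "um_embedding (restrict_space (M \<Otimes>\<^sub>M N) D) (map_prod i j)"
proof -
  have DS: "D \<subseteq> space M \<times> space N"
    using sets.sets_into_space[OF D] by (simp add: space_pair_measure)
  have i[measurable]: "i \<in> M \<rightarrow>\<^sub>M borel" and j[measurable]: "j \<in> N \<rightarrow>\<^sub>M borel"
    and inj: "inj_on i (space M)" "inj_on j (space N)"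
    using M N by (auto simp: um_embedding_def)
  have *: "\<exists>B\<in>sets borel. E = map_prod i j -` B \<inter> space (M \<Otimes>\<^sub>M N)" if "E \<in> sets (M \<Otimes>\<^sub>M N)" for E
    using M N that by (intro pair_vimage_borel) (auto simp: um_embedding_def)
  have sp: "space (restrict_space (M \<Otimes>\<^sub>M N) D) = D"
    using DS by (auto simp: space_restrict_space space_pair_measure)
  show ?thesis
    unfolding um_embedding_def sp
  proof (intro conjI ballI)
    have "map_prod i j \<in> M \<Otimes>\<^sub>M N \<rightarrow>\<^sub>M borel \<Otimes>\<^sub>M borel"
      by (simp add: map_prod_def)
    then show "map_prod i j \<in> restrict_space (M \<Otimes>\<^sub>M N) D \<rightarrow>\<^sub>M borel"
      by (intro measurable_restrict_space1) (simp only: borel_prod)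
    show "inj_on (map_prod i j) D"
      using map_prod_inj_on[OF inj] DS inj_on_subset by blast
  next
    fix E assume "E \<in> sets (restrict_space (M \<Otimes>\<^sub>M N) D)"
    then have E: "E \<subseteq> D" "E \<in> sets (M \<Otimes>\<^sub>M N)" using D by (auto simp: sets_restrict_space_iff)
    obtain B where "B \<in> sets borel" "E = map_prod i j -` B \<inter> space (M \<Otimes>\<^sub>M N)"
      using *[OF E(2)] by blast
    moreover from this have "E = map_prod i j -` B \<inter> D"
      using E(1) DS unfolding space_pair_measure by blast
    ultimately show "\<exists>B\<in>sets borel. E = map_prod i j -` B \<inter> D" by blast
  next
    obtain B where B: "B \<in> sets borel" "D = map_prod i j -` B \<inter> space (M \<Otimes>\<^sub>M N)"
      using *[OF D] by blast
    have "map_prod i j ` D = B \<inter> (fst -` (i ` space M) \<inter> snd -` (j ` space N))"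
      unfolding B(2) by (force simp: space_pair_measure)
    moreover have "universally_measurable euclidean (fst -` (i ` space M) :: ('x \<times> 'y) set)"
      "universally_measurable euclidean (snd -` (j ` space N) :: ('x \<times> 'y) set)"
      using M N by (auto simp: um_embedding_def intro!: universally_measurable_vimage borel_measurable_continuous_onI continuous_intros)
    ultimately show "universally_measurable euclidean (map_prod i j ` D)"
      using B(1) by (simp add: universally_measurable_Int universally_measurable_borel)
  qed
qed

section \<open>Regularity of finite measures on embedded spaces\<close>

text \<open>Universal measurability provides a Borel set \<open>S\<close> inside the image of
  \<open>space M\<close> that misses only part of a null set of the image measure. The mass of
  \<open>A\<close> therefore sits on the Borel set \<open>B \<inter> S\<close>, where compact
  approximation is available, and compact subsets of \<open>B \<inter> S\<close> really lie in the
  image of \<open>A\<close>.\<close>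

lemma um_embedding_inner_regular:
  fixes i :: "'a \<Rightarrow> 'x::{second_countable_topology,complete_space}"
  assumes i: "um_embedding M i" and fin: "finite_measure \<mu>" and s: "sets \<mu> = sets M"
    and A: "A \<in> sets M" and e: "0 < (e :: real)"
  obtains K where "compact K" "K \<subseteq> i ` A" "measure \<mu> A \<le> measure \<mu> (i -` K \<inter> space M) + e"
proof -
  interpret finite_measure \<mu> by fact
  have sp: "space \<mu> = space M" using sets_eq_imp_space_eq[OF s] .
  have im: "i \<in> \<mu> \<rightarrow>\<^sub>M borel" using i measurable_cong_sets[OF s refl] by (auto simp: um_embedding_def)
  define \<nu> where "\<nu> = distr \<mu> borel i"
  interpret \<nu>: finite_measure \<nu> unfolding \<nu>_def using im by (rule finite_measure_distr)
  have s\<nu>: "sets \<nu> = sets borel" by (simp add: \<nu>_def)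
  have \<nu>: "measure \<nu> B = measure \<mu> (i -` B \<inter> space M)" if "B \<in> sets borel" for B
    using that im by (simp add: \<nu>_def measure_distr sp)
  obtain B where B: "B \<in> sets borel" "A = i -` B \<inter> space M"
    using i A by (auto simp: um_embedding_def)
  have "i ` space M \<in> sets (completion \<nu>)"
    using i \<nu>.finite_measure_axioms s\<nu> by (auto simp: um_embedding_def universally_measurable_def sets_borel_of_euclidean)
  then obtain S T T' where S: "i ` space M = S \<union> T" "T \<subseteq> T'" "T' \<in> null_sets \<nu>" "S \<in> sets \<nu>"
    by (rule sets_completionE)
  have S': "S \<in> sets borel" "T' \<in> sets borel" using S s\<nu> by auto
  have "measure \<mu> A \<le> measure \<nu> (B \<inter> S \<union> T')"
    unfolding \<nu>[OF sets.Un[OF sets.Int[OF B(1) S'(1)] S'(2)]]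
  proof (rule finite_measure_mono)
    show "A \<subseteq> i -` (B \<inter> S \<union> T') \<inter> space M" using B(2) S(1,2) by blast
    show "i -` (B \<inter> S \<union> T') \<inter> space M \<in> sets \<mu>"
      using measurable_sets[OF im, of "B \<inter> S \<union> T'"] B S' sp by auto
  qed
  also have "\<dots> = measure \<nu> (B \<inter> S)"
    using S(3) B(1) S' s\<nu> by (simp add: measure_Un_null_set)
  finally have le: "measure \<mu> A \<le> measure \<nu> (B \<inter> S)" .
  have "\<exists>K. compact K \<and> K \<subseteq> B \<inter> S \<and> measure \<nu> (B \<inter> S) - e \<le> measure \<nu> K"
  proof (rule ccontr)
    assume "\<not> ?thesis"
    then have K: "measure \<nu> K < measure \<nu> (B \<inter> S) - e" if "compact K" "K \<subseteq> B \<inter> S" for K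
      using that by (meson not_le)
    have "emeasure \<nu> (B \<inter> S) = (SUP K \<in> {K. K \<subseteq> B \<inter> S \<and> compact K}. emeasure \<nu> K)"
      using B(1) S' s\<nu> by (intro inner_regular) auto
    also have "\<dots> \<le> ennreal (measure \<nu> (B \<inter> S) - e)"
    proof (rule SUP_least)
      fix K assume "K \<in> {K. K \<subseteq> B \<inter> S \<and> compact K}"
      then have "measure \<nu> K \<le> measure \<nu> (B \<inter> S) - e" using K less_imp_le by blast
      then show "emeasure \<nu> K \<le> ennreal (measure \<nu> (B \<inter> S) - e)"
        by (simp add: \<nu>.emeasure_eq_measure ennreal_leI)
    qed
    \<comment> \<open>The case \<open>K = {}\<close> shows that
      \<open>measure \<nu> (B \<inter> S) - e\<close> is positive, so \<open>ennreal\<close> does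
      not truncate it and the inequality is contradictory.\<close>
    finally show False
      using e K[of "{}"] by (simp add: \<nu>.emeasure_eq_measure del: ennreal_minus_eq_top)
  qed
  then obtain K where K: "compact K" "K \<subseteq> B \<inter> S" "measure \<nu> (B \<inter> S) - e \<le> measure \<nu> K" by blast
  show ?thesis
  proof
    show "compact K" by fact
    show "K \<subseteq> i ` A"
    proof
      fix x assume x: "x \<in> K"
      then have "x \<in> i ` space M" using K(2) S(1) by blast
      then obtain a where "a \<in> space M" "x = i a" by blast
      then show "x \<in> i ` A" using x K(2) B(2) by auto
    qed
    have "K \<in> sets borel" using K(1) by (simp add: borel_compact)
    then show "measure \<mu> A \<le> measure \<mu> (i -` K \<inter> space M) + e"
      using le K(3) \<nu>[of K] by linarith
  qed
qed

text \<open>Outer regularity of the image measure is applied to a Borel set \<open>B\<close> whose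
  preimage is \<open>A\<close>.\<close>

lemma um_embedding_outer_regular:
  fixes i :: "'a \<Rightarrow> 'x::{second_countable_topology,complete_space}"
  assumes i: "um_embedding M i" and fin: "finite_measure \<mu>" and s: "sets \<mu> = sets M"
    and A: "A \<in> sets M" and e: "0 < (e :: real)"
  obtains U where "open U" "A \<subseteq> i -` U" "measure \<mu> (i -` U \<inter> space M) \<le> measure \<mu> A + e"
proof -
  interpret finite_measure \<mu> by fact
  have sp: "space \<mu> = space M" using sets_eq_imp_space_eq[OF s] .
  have im: "i \<in> \<mu> \<rightarrow>\<^sub>M borel" using i measurable_cong_sets[OF s refl] by (auto simp: um_embedding_def)
  define \<nu> where "\<nu> = distr \<mu> borel i"
  interpret \<nu>: finite_measure \<nu> unfolding \<nu>_def using im by (rule finite_measure_distr)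
  have s\<nu>: "sets \<nu> = sets borel" by (simp add: \<nu>_def)
  have \<nu>: "measure \<nu> B = measure \<mu> (i -` B \<inter> space M)" if "B \<in> sets borel" for B
    using that im by (simp add: \<nu>_def measure_distr sp)
  obtain B where B: "B \<in> sets borel" "A = i -` B \<inter> space M"
    using i A by (auto simp: um_embedding_def)
  have "(INF U \<in> {U. B \<subseteq> U \<and> open U}. emeasure \<nu> U) = emeasure \<nu> B"
    using B(1) s\<nu> by (intro outer_regular[symmetric]) auto
  also have "\<dots> < ennreal (measure \<nu> B + e)"
    using e by (simp add: \<nu>.emeasure_eq_measure ennreal_less_iff)
  finally obtain U where U: "B \<subseteq> U" "open U" "emeasure \<nu> U < ennreal (measure \<nu> B + e)"
    by (auto simp: INF_less_iff)
  then have "measure \<nu> U < measure \<nu> B + e"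
    by (simp add: \<nu>.emeasure_eq_measure ennreal_less_iff)
  with U show ?thesis
    using B by (intro that[of U]) (auto simp: \<nu>)
qed

section \<open>Limits of couplings with fixed marginals\<close>

lemma semiring_of_rectangles:
  "semiring_of_sets (space M \<times> space N) {A \<times> B |A B. A \<in> sets M \<and> B \<in> sets N}"
proof
  let ?R = "{A \<times> B |A B. A \<in> sets M \<and> B \<in> sets N}"
  show "?R \<subseteq> Pow (space M \<times> space N)"
    by (auto dest: sets.sets_into_space)
  show "{} \<in> ?R" by blast
  fix a b assume "a \<in> ?R" "b \<in> ?R"
  then obtain A B C D where ab: "a = A \<times> B" "b = C \<times> D"
    and s: "A \<in> sets M" "B \<in> sets N" "C \<in> sets M" "D \<in> sets N" by auto
  have "a \<inter> b = (A \<inter> C) \<times> (B \<inter> D)" using ab by blast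
  then show "a \<inter> b \<in> ?R" using s by blast
  show "\<exists>C\<subseteq>?R. finite C \<and> disjoint C \<and> a - b = \<Union> C"
  proof (intro exI conjI)
    let ?C = "{(A - C) \<times> B, (A \<inter> C) \<times> (B - D)}"
    have "(A - C) \<times> B \<in> ?R" "(A \<inter> C) \<times> (B - D) \<in> ?R" using s by blast+
    then show "?C \<subseteq> ?R" by blast
    show "finite ?C" by simp
    show "disjoint ?C" by (auto simp: disjoint_def)
    show "a - b = \<Union> ?C" using ab by blast
  qed
qed

text \<open>Finite sub- and superadditivity of \<beta> on rectangles pass to the limit from the
  measures \<open>m n\<close>, and the fixed marginals control the effect of changing the sides. For
  countable additivity the given rectangle is shrunk to a product of compact sets, the rectangles
  composing it are enlarged to open ones, and a finite subcover is taken. Caratheodory's theorem on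
  the semiring of rectangles then yields the measure.\<close>

lemma bimeasure_extension:
  fixes i :: "'a \<Rightarrow> 'x::{second_countable_topology,complete_space}"
    and j :: "'b \<Rightarrow> 'y::{second_countable_topology,complete_space}"
    and m :: "nat \<Rightarrow> ('a \<times> 'b) measure"
  assumes i: "um_embedding M i" and j: "um_embedding N j"
    and \<mu>: "finite_measure \<mu>" "sets \<mu> = sets M" and \<nu>: "finite_measure \<nu>" "sets \<nu> = sets N"
    and m: "\<And>n. finite_measure (m n)" "\<And>n. sets (m n) = sets (M \<Otimes>\<^sub>M N)"
    and m\<mu>: "\<And>n A. A \<in> sets M \<Longrightarrow> measure (m n) (A \<times> space N) = measure \<mu> A"
    and m\<nu>: "\<And>n B. B \<in> sets N \<Longrightarrow> measure (m n) (space M \<times> B) = measure \<nu> B"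
    and lim: "\<And>A B. A \<in> sets M \<Longrightarrow> B \<in> sets N \<Longrightarrow> (\<lambda>n. measure (m n) (A \<times> B)) \<longlonglongrightarrow> \<beta> A B"
  shows "\<exists>\<rho>. sets \<rho> = sets (M \<Otimes>\<^sub>M N) \<and>
    (\<forall>A\<in>sets M. \<forall>B\<in>sets N. emeasure \<rho> (A \<times> B) = ennreal (\<beta> A B))"
proof -
  interpret \<mu>: finite_measure \<mu> by fact
  interpret \<nu>: finite_measure \<nu> by fact
  interpret m: finite_measure "m n" for n by fact
  have rect: "A \<times> B \<in> sets (m n)" if "A \<in> sets M" "B \<in> sets N" for A B n
    using that by (simp add: m)
  have \<beta>_nonneg: "0 \<le> \<beta> A B" if "A \<in> sets M" "B \<in> sets N" for A B
    by (rule LIMSEQ_le_const[OF lim[OF that]]) simp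
  have \<beta>_sub: "\<beta> A B \<le> (\<Sum>k\<in>I. \<beta> (C k) (D k))"
    if "A \<in> sets M" "B \<in> sets N" "finite I" "\<And>k. k \<in> I \<Longrightarrow> C k \<in> sets M" "\<And>k. k \<in> I \<Longrightarrow> D k \<in> sets N"
      "A \<times> B \<subseteq> (\<Union>k\<in>I. C k \<times> D k)" for A B and I :: "nat set" and C D
  proof (rule LIMSEQ_le)
    show "(\<lambda>n. measure (m n) (A \<times> B)) \<longlonglongrightarrow> \<beta> A B" using that by (intro lim)
    show "(\<lambda>n. \<Sum>k\<in>I. measure (m n) (C k \<times> D k)) \<longlonglongrightarrow> (\<Sum>k\<in>I. \<beta> (C k) (D k))"
      using that by (intro tendsto_sum lim)
    have "measure (m n) (A \<times> B) \<le> (\<Sum>k\<in>I. measure (m n) (C k \<times> D k))" for n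
    proof -
      have "measure (m n) (A \<times> B) \<le> measure (m n) (\<Union>k\<in>I. C k \<times> D k)"
        using that rect by (intro m.finite_measure_mono sets.finite_UN) auto
      also have "\<dots> \<le> (\<Sum>k\<in>I. measure (m n) (C k \<times> D k))"
        using that rect by (intro m.finite_measure_subadditive_finite) auto
      finally show ?thesis .
    qed
    then show "\<exists>n0. \<forall>n\<ge>n0. measure (m n) (A \<times> B) \<le> (\<Sum>k\<in>I. measure (m n) (C k \<times> D k))" by blast
  qed
  have \<beta>_super: "(\<Sum>k\<in>I. \<beta> (C k) (D k)) \<le> \<beta> A B"
    if "A \<in> sets M" "B \<in> sets N" "finite I" "\<And>k. k \<in> I \<Longrightarrow> C k \<in> sets M" "\<And>k. k \<in> I \<Longrightarrow> D k \<in> sets N"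
      "disjoint_family_on (\<lambda>k. C k \<times> D k) I" "(\<Union>k\<in>I. C k \<times> D k) \<subseteq> A \<times> B" for A B and I :: "nat set" and C D
  proof (rule LIMSEQ_le)
    show "(\<lambda>n. measure (m n) (A \<times> B)) \<longlonglongrightarrow> \<beta> A B" using that by (intro lim)
    show "(\<lambda>n. \<Sum>k\<in>I. measure (m n) (C k \<times> D k)) \<longlonglongrightarrow> (\<Sum>k\<in>I. \<beta> (C k) (D k))"
      using that by (intro tendsto_sum lim)
    have "(\<Sum>k\<in>I. measure (m n) (C k \<times> D k)) \<le> measure (m n) (A \<times> B)" for n
    proof -
      have "(\<Sum>k\<in>I. measure (m n) (C k \<times> D k)) = measure (m n) (\<Union>k\<in>I. C k \<times> D k)"
        using that rect by (intro m.finite_measure_finite_Union[symmetric]) auto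
      also have "\<dots> \<le> measure (m n) (A \<times> B)"
        using that rect by (intro m.finite_measure_mono) auto
      finally show ?thesis .
    qed
    then show "\<exists>n0. \<forall>n\<ge>n0. (\<Sum>k\<in>I. measure (m n) (C k \<times> D k)) \<le> measure (m n) (A \<times> B)" by blast
  qed
  \<comment> \<open>The part of \<open>C \<times> D\<close> outside \<open>A \<times> B\<close> lies
    in two strips whose masses are differences of marginals and hence the same for all
    \<open>n\<close>.\<close>
  have \<beta>_diff: "\<beta> C D \<le> \<beta> A B + (measure \<mu> C - measure \<mu> A) + (measure \<nu> D - measure \<nu> B)"
    if s: "A \<in> sets M" "B \<in> sets N" "C \<in> sets M" "D \<in> sets N" and sub: "A \<subseteq> C" "B \<subseteq> D" for A B C D
  proof (rule LIMSEQ_le)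
    show "(\<lambda>n. measure (m n) (C \<times> D)) \<longlonglongrightarrow> \<beta> C D" using s by (intro lim)
    show "(\<lambda>n. measure (m n) (A \<times> B) + (measure \<mu> C - measure \<mu> A) + (measure \<nu> D - measure \<nu> B))
        \<longlonglongrightarrow> \<beta> A B + (measure \<mu> C - measure \<mu> A) + (measure \<nu> D - measure \<nu> B)"
      using s by (intro tendsto_intros lim)
    have "measure (m n) (C \<times> D) \<le> measure (m n) (A \<times> B) + (measure \<mu> C - measure \<mu> A) + (measure \<nu> D - measure \<nu> B)" for n
    proof -
      have "C \<times> D \<subseteq> A \<times> B \<union> (C - A) \<times> space N \<union> space M \<times> (D - B)"
        using s(3,4)[THEN sets.sets_into_space] by blast
      then have "measure (m n) (C \<times> D) \<le> measure (m n) (A \<times> B \<union> (C - A) \<times> space N \<union> space M \<times> (D - B))"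
        using s by (intro m.finite_measure_mono) (auto intro!: sets.Un rect)
      also have "\<dots> \<le> measure (m n) (A \<times> B \<union> (C - A) \<times> space N) + measure (m n) (space M \<times> (D - B))"
        using s by (intro measure_Un_le) (auto intro!: sets.Un rect)
      also have "\<dots> \<le> measure (m n) (A \<times> B) + measure (m n) ((C - A) \<times> space N) + measure (m n) (space M \<times> (D - B))"
        using s by (intro add_right_mono measure_Un_le) (auto intro!: rect)
      also have "measure (m n) ((C - A) \<times> space N) = measure \<mu> C - measure \<mu> A"
        using s sub \<mu> m\<mu>[of "C - A" n] by (simp add: \<mu>.finite_measure_Diff)
      also have "measure (m n) (space M \<times> (D - B)) = measure \<nu> D - measure \<nu> B"
        using s sub \<nu> m\<nu>[of "D - B" n] by (simp add: \<nu>.finite_measure_Diff)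
      finally show ?thesis .
    qed
    then show "\<exists>n0. \<forall>n\<ge>n0. measure (m n) (C \<times> D) \<le>
        measure (m n) (A \<times> B) + (measure \<mu> C - measure \<mu> A) + (measure \<nu> D - measure \<nu> B)" by blast
  qed
  have im: "i -` X \<inter> space M \<in> sets M" if "X \<in> sets borel" for X
    using i that by (auto simp: um_embedding_def intro: measurable_sets)
  have jm: "j -` X \<inter> space N \<in> sets N" if "X \<in> sets borel" for X
    using j that by (auto simp: um_embedding_def intro: measurable_sets)
  define \<rho> where "\<rho> = extend_measure (space M \<times> space N) {(A, B). A \<in> sets M \<and> B \<in> sets N}
     (\<lambda>(A, B). A \<times> B) (\<lambda>(A, B). ennreal (\<beta> A B))"
  show ?thesis
  proof (intro exI conjI ballI)
    have "(\<lambda>(A, B). A \<times> B) ` {(A, B). A \<in> sets M \<and> B \<in> sets N} = {A \<times> B |A B. A \<in> sets M \<and> B \<in> sets N}"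
      by auto
    moreover have "{A \<times> B |A B. A \<in> sets M \<and> B \<in> sets N} \<subseteq> Pow (space M \<times> space N)"
      by (auto dest: sets.sets_into_space)
    ultimately show "sets \<rho> = sets (M \<Otimes>\<^sub>M N)"
      by (simp add: \<rho>_def sets_extend_measure sets_pair_measure)
  next
    fix A0 B0 assume "A0 \<in> sets M" "B0 \<in> sets N"
    then show "emeasure \<rho> (A0 \<times> B0) = ennreal (\<beta> A0 B0)"
    proof (intro extend_measure_caratheodory_pair[OF \<rho>_def])
      \<comment> \<open>An empty rectangle has many representations; \<beta> agrees on them because
        \<open>m n\<close> sees only the product set.\<close>
      fix A B C D assume "A \<in> sets M \<and> B \<in> sets N" "C \<in> sets M \<and> D \<in> sets N" "A \<times> B = C \<times> D"
      then show "ennreal (\<beta> A B) = ennreal (\<beta> C D)"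
        using lim[of A B] lim[of C D] LIMSEQ_unique[of "\<lambda>n. measure (m n) (C \<times> D)" "\<beta> A B" "\<beta> C D"]
        by simp
    next
      fix A B assume "A \<in> sets M \<and> B \<in> sets N" "A \<times> B = {}"
      then show "ennreal (\<beta> A B) = 0"
        using lim[of A B] LIMSEQ_unique[of "\<lambda>n. 0" "\<beta> A B" 0] by auto
    next
      fix C D :: "nat \<Rightarrow> _ set" and A B
      assume CD: "\<And>n. C n \<in> sets M \<and> D n \<in> sets N" and AB: "A \<in> sets M \<and> B \<in> sets N"
        and disj: "disjoint_family (\<lambda>n. C n \<times> D n)" and un: "(\<Union>n. C n \<times> D n) = A \<times> B"
      show "(\<Sum>n. ennreal (\<beta> (C n) (D n))) = ennreal (\<beta> A B)"
      proof (rule antisym)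
        show "(\<Sum>n. ennreal (\<beta> (C n) (D n))) \<le> ennreal (\<beta> A B)"
        proof (rule suminf_le_const)
          fix n
          have "(\<Union>k<n. C k \<times> D k) \<subseteq> A \<times> B" unfolding un[symmetric] by (rule UN_mono) auto
          moreover have "disjoint_family_on (\<lambda>k. C k \<times> D k) {..<n}"
            using disj by (rule disjoint_family_on_mono[rotated]) simp
          ultimately have "(\<Sum>k<n. \<beta> (C k) (D k)) \<le> \<beta> A B"
            using CD AB by (intro \<beta>_super) auto
          then show "(\<Sum>k<n. ennreal (\<beta> (C k) (D k))) \<le> ennreal (\<beta> A B)"
            using CD \<beta>_nonneg by (subst sum_ennreal) (auto intro: ennreal_leI)
        qed simp
        show "ennreal (\<beta> A B) \<le> (\<Sum>n. ennreal (\<beta> (C n) (D n)))"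
        proof (rule ennreal_le_epsilon)
          fix e :: real assume e: "0 < e"
          \<comment> \<open>The error budget: \<open>e / 4\<close> for each of the two compact sets,
            and \<delta>, of total \<open>e / 4\<close>, counted twice because both sides of each
            rectangle are enlarged.\<close>
          define \<delta> where "\<delta> n = e / 4 * (1/2) ^ Suc n" for n
          have \<delta>: "0 < \<delta> n" for n using e by (simp add: \<delta>_def)
          have AB': "A \<in> sets M" "B \<in> sets N" and e4: "0 < e / 4" using AB e by auto
          obtain K where K: "compact K" "K \<subseteq> i ` A" "measure \<mu> A \<le> measure \<mu> (i -` K \<inter> space M) + e / 4"
            by (rule um_embedding_inner_regular[OF i \<mu> AB'(1) e4])
          obtain J where J: "compact J" "J \<subseteq> j ` B" "measure \<nu> B \<le> measure \<nu> (j -` J \<inter> space N) + e / 4"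
            by (rule um_embedding_inner_regular[OF j \<nu> AB'(2) e4])
          have "\<exists>U. open U \<and> C n \<subseteq> i -` U \<and> measure \<mu> (i -` U \<inter> space M) \<le> measure \<mu> (C n) + \<delta> n" for n
            using um_embedding_outer_regular[OF i \<mu>, of "C n" "\<delta> n"] CD \<delta> by metis
          then obtain U where U: "\<And>n. open (U n)" "\<And>n. C n \<subseteq> i -` U n"
            "\<And>n. measure \<mu> (i -` U n \<inter> space M) \<le> measure \<mu> (C n) + \<delta> n" by metis
          have "\<exists>V. open V \<and> D n \<subseteq> j -` V \<and> measure \<nu> (j -` V \<inter> space N) \<le> measure \<nu> (D n) + \<delta> n" for n
            using um_embedding_outer_regular[OF j \<nu>, of "D n" "\<delta> n"] CD \<delta> by metis
          then obtain V where V: "\<And>n. open (V n)" "\<And>n. D n \<subseteq> j -` V n"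
            "\<And>n. measure \<nu> (j -` V n \<inter> space N) \<le> measure \<nu> (D n) + \<delta> n" by metis
          let ?K = "i -` K \<inter> space M" and ?J = "j -` J \<inter> space N"
          let ?U = "\<lambda>n. i -` U n \<inter> space M" and ?V = "\<lambda>n. j -` V n \<inter> space N"
          have KJ: "?K \<in> sets M" "?J \<in> sets N"
            using K(1) J(1) by (auto intro: im jm borel_compact)
          have UV: "?U n \<in> sets M" "?V n \<in> sets N" for n
            using U(1) V(1) by (auto intro: im jm borel_open)
          have AS: "A \<subseteq> space M" "B \<subseteq> space N" using AB sets.sets_into_space by blast+
          have "?K \<subseteq> A"
          proof
            fix a assume a: "a \<in> ?K"
            then obtain a' where "a' \<in> A" "i a = i a'" using K(2) by auto
            then show "a \<in> A"
              using i a AS by (auto simp: um_embedding_def dest: inj_onD)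
          qed
          moreover have "?J \<subseteq> B"
          proof
            fix b assume b: "b \<in> ?J"
            then obtain b' where "b' \<in> B" "j b = j b'" using J(2) by auto
            then show "b \<in> B"
              using j b AS by (auto simp: um_embedding_def dest: inj_onD)
          qed
          ultimately have "\<beta> A B \<le> \<beta> ?K ?J + (measure \<mu> A - measure \<mu> ?K) + (measure \<nu> B - measure \<nu> ?J)"
            using AB KJ by (intro \<beta>_diff) auto
          then have 1: "\<beta> A B \<le> \<beta> ?K ?J + e / 2" using K(3) J(3) by linarith
          have cover: "K \<times> J \<subseteq> (\<Union>n. U n \<times> V n)"
          proof
            fix p assume "p \<in> K \<times> J"
            then obtain x y where p: "p = (x, y)" "x \<in> K" "y \<in> J" by (rule SigmaE)
            then have "x \<in> i ` A" "y \<in> j ` B" using K(2) J(2) by auto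
            then obtain a b where ab: "a \<in> A" "b \<in> B" "p = (i a, j b)" using p(1) by auto
            then have "(a, b) \<in> (\<Union>n. C n \<times> D n)" using un by simp
            then obtain n where "a \<in> C n" "b \<in> D n" by blast
            then show "p \<in> (\<Union>n. U n \<times> V n)" using U(2) V(2) ab(3) by blast
          qed
          have op: "open (U n \<times> V n)" for n using U(1) V(1) by (rule open_Times)
          \<comment> \<open>Compactness replaces the countable cover by a finite one, to which
            \<open>\<beta>_sub\<close> applies.\<close>
          obtain I where I: "finite I" "K \<times> J \<subseteq> (\<Union>n\<in>I. U n \<times> V n)"
            using compactE_image[OF compact_Times[OF K(1) J(1)] op cover] by metis
          have "\<beta> ?K ?J \<le> (\<Sum>n\<in>I. \<beta> (?U n) (?V n))"
          proof (rule \<beta>_sub[OF KJ I(1) UV])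
            show "?K \<times> ?J \<subseteq> (\<Union>n\<in>I. ?U n \<times> ?V n)"
            proof
              fix p assume "p \<in> ?K \<times> ?J"
              then obtain a b where p: "p = (a, b)" "a \<in> space M" "b \<in> space N" "(i a, j b) \<in> K \<times> J" by auto
              then obtain n where "n \<in> I" "(i a, j b) \<in> U n \<times> V n" using I(2) by blast
              then show "p \<in> (\<Union>n\<in>I. ?U n \<times> ?V n)" using p by auto
            qed
          qed
          also have "\<dots> \<le> (\<Sum>n\<in>I. \<beta> (C n) (D n) + 2 * \<delta> n)"
          proof (rule sum_mono)
            fix n assume "n \<in> I"
            have "\<beta> (?U n) (?V n) \<le> \<beta> (C n) (D n) + (measure \<mu> (?U n) - measure \<mu> (C n)) + (measure \<nu> (?V n) - measure \<nu> (D n))"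
            proof (rule \<beta>_diff)
              show "C n \<in> sets M" "D n \<in> sets N" using CD by simp_all
              then show "C n \<subseteq> ?U n" "D n \<subseteq> ?V n" using U(2)[of n] V(2)[of n] sets.sets_into_space by blast+
            qed (rule UV)+
            then show "\<beta> (?U n) (?V n) \<le> \<beta> (C n) (D n) + 2 * \<delta> n"
              using U(3)[of n] V(3)[of n] by linarith
          qed
          also have "\<dots> = (\<Sum>n\<in>I. \<beta> (C n) (D n)) + 2 * (\<Sum>n\<in>I. \<delta> n)"
            by (simp add: sum.distrib sum_distrib_left)
          also have "(\<Sum>n\<in>I. \<delta> n) \<le> e / 4"
          proof -
            have s: "\<delta> sums (e / 4)"
              unfolding \<delta>_def using sums_mult[OF power_half_series, of "e / 4"] by simp
            then have "(\<Sum>n\<in>I. \<delta> n) \<le> suminf \<delta>"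
              using I(1) \<delta> less_imp_le by (intro sum_le_suminf) (auto simp: sums_iff)
            then show ?thesis using s by (simp add: sums_iff)
          qed
          finally have "\<beta> A B \<le> (\<Sum>n\<in>I. \<beta> (C n) (D n)) + e" using 1 by linarith
          then have "ennreal (\<beta> A B) \<le> ennreal ((\<Sum>n\<in>I. \<beta> (C n) (D n)) + e)" by (rule ennreal_leI)
          also have "\<dots> = (\<Sum>n\<in>I. ennreal (\<beta> (C n) (D n))) + ennreal e"
            using e CD \<beta>_nonneg by (simp add: ennreal_plus sum_nonneg sum_ennreal)
          also have "\<dots> \<le> (\<Sum>n. ennreal (\<beta> (C n) (D n))) + ennreal e"
            using I(1) by (intro add_right_mono sum_le_suminf) auto
          finally show "ennreal (\<beta> A B) \<le> (\<Sum>n. ennreal (\<beta> (C n) (D n))) + ennreal e" .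
        qed
      qed
    qed (auto intro: semiring_of_rectangles)
  qed
qed

section \<open>Couplings over refining partitions\<close>

text \<open>The subsets of \<open>{..<Suc n}\<close> are those without \<open>n\<close> and those
  with \<open>n\<close>, that is, the two children of each index of level \<open>n\<close>.\<close>

lemma sum_Pow_lessThan_Suc:
  fixes f :: "nat set \<Rightarrow> 'a::comm_monoid_add"
  shows "(\<Sum>c\<in>Pow {..<Suc n}. f c) = (\<Sum>c\<in>Pow {..<n}. f c + f (insert n c))"
proof -
  have inj: "inj_on (insert n) (Pow {..<n})"
  proof (rule inj_onI)
    fix c d assume "c \<in> Pow {..<n}" "d \<in> Pow {..<n}" "insert n c = insert n d"
    then show "c = d" by (metis Diff_insert_absorb PowD lessThan_iff less_irrefl subsetD)
  qed
  have "(\<Sum>c\<in>Pow {..<Suc n}. f c) = (\<Sum>c\<in>Pow {..<n} \<union> insert n ` Pow {..<n}. f c)"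
    by (simp add: lessThan_Suc Pow_insert)
  also have "\<dots> = (\<Sum>c\<in>Pow {..<n}. f c) + (\<Sum>c\<in>insert n ` Pow {..<n}. f c)"
    by (rule sum.union_disjoint) auto
  also have "(\<Sum>c\<in>insert n ` Pow {..<n}. f c) = (\<Sum>c\<in>Pow {..<n}. f (insert n c))"
    by (simp add: sum.reindex[OF inj])
  finally show ?thesis by (simp add: sum.distrib)
qed

text \<open>An additive mass on a binary tree: a subset \<open>c\<close> of \<open>{..<n}\<close> is
  a node of level \<open>n\<close>, and its children at level \<open>Suc n\<close> are
  \<open>c\<close> and \<open>insert n c\<close>.\<close>

definition refining :: "(nat \<Rightarrow> nat set \<Rightarrow> real) \<Rightarrow> bool" where
  "refining r \<longleftrightarrow> (\<forall>n. \<forall>c\<in>Pow {..<n}. r n c = r (Suc n) c + r (Suc n) (insert n c))"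

lemma refining_sum:
  assumes "refining r"
  shows "(\<Sum>c\<in>Pow {..<n}. r n c) = r 0 {}"
proof (induction n)
  case (Suc n)
  have "(\<Sum>c\<in>Pow {..<Suc n}. r (Suc n) c) = (\<Sum>c\<in>Pow {..<n}. r n c)"
    unfolding sum_Pow_lessThan_Suc using assms by (intro sum.cong) (auto simp: refining_def)
  then show ?case using Suc by simp
qed simp

text \<open>This is the Cauchy-Schwarz inequality in quotient form, or the joint convexity of
  \<open>x\<^sup>2 / u\<close>: the difference of the sides is a square over a positive number. If
  \<open>u\<close> or \<open>v\<close> is 0, so is its numerator, and with \<open>x / 0 = 0\<close>
  both sides agree.\<close>

lemma square_div_add_le:
  fixes x y u v :: real
  assumes "0 \<le> u" "0 \<le> v" "u = 0 \<Longrightarrow> x = 0" "v = 0 \<Longrightarrow> y = 0"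
  shows "(x + y)\<^sup>2 / (u + v) \<le> x\<^sup>2 / u + y\<^sup>2 / v"
proof (cases "u = 0 \<or> v = 0")
  case True
  then show ?thesis using assms(3,4) by auto
next
  case False
  then have uv: "0 < u" "0 < v" using assms by auto
  have "x\<^sup>2 / u + y\<^sup>2 / v - (x + y)\<^sup>2 / (u + v) = (x * v - y * u)\<^sup>2 / (u * v * (u + v))"
    using uv by (simp add: divide_simps) (simp add: algebra_simps power2_eq_square)
  moreover have "0 \<le> (x * v - y * u)\<^sup>2 / (u * v * (u + v))"
    using uv by (intro divide_nonneg_nonneg) auto
  ultimately show ?thesis by linarith
qed

text \<open>Splitting a cell can only increase the sum, by \<open>square_div_add_le\<close>. The
  bound \<open>r \<le> C * w\<close> makes each term at most \<open>C\<^sup>2 * w\<close>, and the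
  masses \<open>w\<close> of a level add up to \<open>w 0 {}\<close>.\<close>

lemma refining_square_convergent:
  assumes r: "refining r" and w: "refining w"
    and bound: "\<And>n c. 0 \<le> r n c" "\<And>n c. r n c \<le> C * w n c" and w0: "\<And>n c. 0 \<le> w n c"
  shows "convergent (\<lambda>n. \<Sum>c\<in>Pow {..<n}. (r n c)\<^sup>2 / w n c)"
proof -
  let ?S = "\<lambda>n. \<Sum>c\<in>Pow {..<n}. (r n c)\<^sup>2 / w n c"
  have z: "r n c = 0" if "w n c = 0" for n c
    using bound(1)[of n c] bound(2)[of n c] that by simp
  have "incseq ?S"
  proof (rule incseq_SucI)
    fix n
    have "?S n = (\<Sum>c\<in>Pow {..<n}. (r (Suc n) c + r (Suc n) (insert n c))\<^sup>2 / (w (Suc n) c + w (Suc n) (insert n c)))"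
      using r w by (intro sum.cong) (auto simp: refining_def)
    also have "\<dots> \<le> (\<Sum>c\<in>Pow {..<n}. (r (Suc n) c)\<^sup>2 / w (Suc n) c + (r (Suc n) (insert n c))\<^sup>2 / w (Suc n) (insert n c))"
      by (intro sum_mono square_div_add_le w0 z)
    also have "\<dots> = ?S (Suc n)" unfolding sum_Pow_lessThan_Suc ..
    finally show "?S n \<le> ?S (Suc n)" .
  qed
  moreover have "?S n \<le> C\<^sup>2 * w 0 {}" for n
  proof -
    have "(r n c)\<^sup>2 / w n c \<le> C\<^sup>2 * w n c" for c
    proof (cases "w n c = 0")
      case False
      then have "0 < w n c" using w0[of n c] by simp
      moreover have "(r n c)\<^sup>2 \<le> (C * w n c)\<^sup>2" using bound by (intro power_mono) auto
      ultimately show ?thesis by (simp add: divide_le_eq power2_eq_square algebra_simps)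
    qed simp
    then have "?S n \<le> (\<Sum>c\<in>Pow {..<n}. C\<^sup>2 * w n c)" by (rule sum_mono)
    also have "\<dots> = C\<^sup>2 * w 0 {}" by (simp add: refining_sum[OF w] flip: sum_distrib_left)
    finally show ?thesis .
  qed
  ultimately obtain L where "?S \<longlonglongrightarrow> L"
    using incseq_convergent[of ?S "C\<^sup>2 * w 0 {}"] by blast
  then show ?thesis by (rule convergentI)
qed

text \<open>Polarization writes \<open>p * q\<close> as half of
  \<open>(p + q)\<^sup>2 - p\<^sup>2 - q\<^sup>2\<close> and so reduces mixed sums to three monotone
  ones; the constant 2 comes from bounding \<open>p + q\<close> by \<open>2 * w\<close>.\<close>

lemma refining_product_convergent:
  assumes p: "refining p" "\<And>n c. 0 \<le> p n c" "\<And>n c. p n c \<le> w n c"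
    and q: "refining q" "\<And>n c. 0 \<le> q n c" "\<And>n c. q n c \<le> w n c" and w: "refining w"
  shows "convergent (\<lambda>n. \<Sum>c\<in>Pow {..<n}. p n c * q n c / w n c)"
proof -
  have w0: "0 \<le> w n c" for n c using p(2)[of n c] p(3)[of n c] by linarith
  let ?S = "\<lambda>r n. \<Sum>c\<in>Pow {..<n}. (r n c)\<^sup>2 / w n c"
  have "convergent (?S p)"
    by (rule refining_square_convergent[where C = 1]) (use p w w0 in auto)
  moreover have "convergent (?S q)"
    by (rule refining_square_convergent[where C = 1]) (use q w w0 in auto)
  moreover have "convergent (?S (\<lambda>n c. p n c + q n c))"
  proof (rule refining_square_convergent[where C = 2])
    show "refining (\<lambda>n c. p n c + q n c)" using p(1) q(1) by (simp add: refining_def)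
    show "0 \<le> p n c + q n c" for n c using p(2) q(2) by simp
    show "p n c + q n c \<le> 2 * w n c" for n c using p(3)[of n c] q(3)[of n c] by linarith
  qed (use w w0 in auto)
  ultimately have "convergent (\<lambda>n. 1/2 * (?S (\<lambda>n c. p n c + q n c) n - ?S p n - ?S q n))"
    by (intro convergent_mult convergent_diff convergent_const)
  moreover have "1/2 * (?S (\<lambda>n c. p n c + q n c) n - ?S p n - ?S q n) = (\<Sum>c\<in>Pow {..<n}. p n c * q n c / w n c)" for n
    unfolding sum_subtractf[symmetric] sum_distrib_left
    by (intro sum.cong refl) (simp add: power2_sum add_divide_distrib)
  ultimately show ?thesis by simp
qed

section \<open>Cells of a sequence of sets and the couplings they define\<close>

text \<open>The atoms of the partition generated by the first \<open>n\<close> sets, with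
  \<open>c\<close> recording membership. Some of them may be empty.\<close>

definition cell :: "(nat \<Rightarrow> 'c set) \<Rightarrow> nat \<Rightarrow> nat set \<Rightarrow> 'c set" where
  "cell U n c = {x. \<forall>k<n. x \<in> U k \<longleftrightarrow> k \<in> c}"

lemma cell_0 [simp]: "cell U 0 c = UNIV"
  by (simp add: cell_def)

lemma cell_Suc:
  assumes "c \<in> Pow {..<n}"
  shows "cell U n c = cell U (Suc n) c \<union> cell U (Suc n) (insert n c)"
    and "cell U (Suc n) c \<inter> cell U (Suc n) (insert n c) = {}"
proof -
  have c: "n \<notin> c" using assms by auto
  have 1: "cell U (Suc n) c = cell U n c - U n"
    using c by (auto simp: cell_def less_Suc_eq)
  have 2: "cell U (Suc n) (insert n c) = cell U n c \<inter> U n"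
    by (auto simp: cell_def less_Suc_eq)
  show "cell U n c = cell U (Suc n) c \<union> cell U (Suc n) (insert n c)"
    "cell U (Suc n) c \<inter> cell U (Suc n) (insert n c) = {}"
    unfolding 1 2 by auto
qed

lemma sets_vimage_cell:
  assumes h: "h \<in> M \<rightarrow>\<^sub>M S" and U: "\<And>k. U k \<in> sets S"
  shows "h -` cell U n c \<inter> space M \<in> sets M"
proof (induction n)
  case (Suc n)
  have "h -` U n \<inter> space M \<in> sets M" using h U by (rule measurable_sets)
  moreover have "h -` cell U (Suc n) c \<inter> space M =
      (h -` cell U n c \<inter> space M) \<inter> (if n \<in> c then h -` U n \<inter> space M else space M - (h -` U n \<inter> space M))"
    by (auto simp: cell_def less_Suc_eq)
  ultimately show ?case using Suc by auto
qed simp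

lemma refining_measure_cell:
  assumes \<mu>: "finite_measure \<mu>" "sets \<mu> = sets M" and h: "h \<in> M \<rightarrow>\<^sub>M S" and U: "\<And>k. U k \<in> sets S"
    and A: "A \<in> sets M"
  shows "refining (\<lambda>n c. measure \<mu> (A \<inter> h -` cell U n c))"
  unfolding refining_def
proof (intro allI ballI)
  interpret finite_measure \<mu> by fact
  have s: "A \<inter> h -` cell U n c \<in> sets \<mu>" for n :: nat and c
  proof -
    have "A \<inter> h -` cell U n c = A \<inter> (h -` cell U n c \<inter> space M)"
      using sets.sets_into_space[OF A] by auto
    then show ?thesis using A sets_vimage_cell[OF h U] \<mu>(2) by simp
  qed
  fix n :: nat and c assume c: "c \<in> Pow {..<n}"
  have "A \<inter> h -` cell U n c = (A \<inter> h -` cell U (Suc n) c) \<union> (A \<inter> h -` cell U (Suc n) (insert n c))"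
    unfolding cell_Suc(1)[OF c] by auto
  moreover have "(A \<inter> h -` cell U (Suc n) c) \<inter> (A \<inter> h -` cell U (Suc n) (insert n c)) = {}"
    using cell_Suc(2)[OF c, of U] by auto
  ultimately show "measure \<mu> (A \<inter> h -` cell U n c) =
      measure \<mu> (A \<inter> h -` cell U (Suc n) c) + measure \<mu> (A \<inter> h -` cell U (Suc n) (insert n c))"
    using s by (simp add: finite_measure_Union)
qed

text \<open>Cells of \<open>\<mu>\<close>-measure 0 contribute 0 to the sum, by the convention \<open>x / 0 = 0\<close>.\<close>

definition cell_coupling ::
  "(nat \<Rightarrow> 'c set) \<Rightarrow> ('a \<Rightarrow> 'c) \<Rightarrow> ('b \<Rightarrow> 'c) \<Rightarrow> 'a measure \<Rightarrow> 'b measure \<Rightarrow> nat \<Rightarrow> 'a set \<Rightarrow> 'b set \<Rightarrow> real" where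
  "cell_coupling U h g \<mu> \<nu> n A B = (\<Sum>c\<in>Pow {..<n}.
     measure \<mu> (A \<inter> h -` cell U n c) * measure \<nu> (B \<inter> g -` cell U n c) / measure \<mu> (space \<mu> \<inter> h -` cell U n c))"

text \<open>At level \<open>n\<close> the coupling makes the two coordinates independent within each
  cell, so it has an explicit density with respect to the product measure. Since \<mu> and \<nu>
  give every cell of the base the same mass, its marginals are \<mu> and \<nu> at each level. The
  values on rectangles converge by \<open>refining_product_convergent\<close>, and
  \<open>bimeasure_extension\<close> turns the limit into a measure.\<close>

lemma coupling_exists:
  fixes i :: "'a \<Rightarrow> 'x::{second_countable_topology,complete_space}"
    and j :: "'b \<Rightarrow> 'y::{second_countable_topology,complete_space}"
  assumes i: "um_embedding M i" and j: "um_embedding N j"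
    and \<mu>: "finite_measure \<mu>" "sets \<mu> = sets M" and \<nu>: "finite_measure \<nu>" "sets \<nu> = sets N"
    and h: "h \<in> M \<rightarrow>\<^sub>M S" and g: "g \<in> N \<rightarrow>\<^sub>M S" and U: "\<And>k. U k \<in> sets S"
    and eq: "\<And>Q. Q \<in> sets S \<Longrightarrow> measure \<mu> (h -` Q \<inter> space M) = measure \<nu> (g -` Q \<inter> space N)"
  obtains \<rho> where "sets \<rho> = sets (M \<Otimes>\<^sub>M N)"
    "\<And>A B. A \<in> sets M \<Longrightarrow> B \<in> sets N \<Longrightarrow> emeasure \<rho> (A \<times> B) = ennreal (lim (\<lambda>n. cell_coupling U h g \<mu> \<nu> n A B))"
    "\<And>A. A \<in> sets M \<Longrightarrow> emeasure \<rho> (A \<times> space N) = emeasure \<mu> A"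
    "\<And>B. B \<in> sets N \<Longrightarrow> emeasure \<rho> (space M \<times> B) = emeasure \<nu> B"
    "\<And>k. (h -` U k \<inter> space M) \<times> (space N - g -` U k) \<in> null_sets \<rho>"
    "\<And>k. (space M - h -` U k) \<times> (g -` U k \<inter> space N) \<in> null_sets \<rho>"
proof -
  interpret \<mu>: finite_measure \<mu> by fact
  interpret \<nu>: finite_measure \<nu> by fact
  have sp: "space \<mu> = space M" "space \<nu> = space N"
    using \<mu>(2) \<nu>(2) sets_eq_imp_space_eq by blast+
  let ?H = "\<lambda>n c. space M \<inter> h -` cell U n c" and ?G = "\<lambda>n c. space N \<inter> g -` cell U n c"
  define w where "w n c = measure \<mu> (?H n c)" for n c
  have HG: "?H n c \<in> sets M" "?G n c \<in> sets N" for n c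
    using sets_vimage_cell[OF h U] sets_vimage_cell[OF g U] by (simp_all add: Int_commute)
  \<comment> \<open>Applied to the trace of a cell on the base, \<open>eq\<close> gives both
    measures the same mass over that cell, so the single weight \<open>w\<close> normalizes either
    factor.\<close>
  have w: "measure \<nu> (?G n c) = w n c" for n c
  proof -
    have id: "(\<lambda>x. x) \<in> S \<rightarrow>\<^sub>M S" by simp
    have "(\<lambda>x. x) -` cell U n c \<inter> space S \<in> sets S" by (rule sets_vimage_cell[OF id U])
    then have Q: "cell U n c \<inter> space S \<in> sets S" by simp
    have "h -` (cell U n c \<inter> space S) \<inter> space M = ?H n c" "g -` (cell U n c \<inter> space S) \<inter> space N = ?G n c"
      using measurable_space[OF h] measurable_space[OF g] by auto
    then show ?thesis using eq[OF Q] by (simp add: w_def)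
  qed
  let ?p = "\<lambda>A n c. measure \<mu> (A \<inter> h -` cell U n c)" and ?q = "\<lambda>B n c. measure \<nu> (B \<inter> g -` cell U n c)"
  have cc: "cell_coupling U h g \<mu> \<nu> n A B = (\<Sum>c\<in>Pow {..<n}. ?p A n c * ?q B n c / w n c)" for n A B
    by (simp add: cell_coupling_def w_def sp)
  have p: "refining (?p A)" "?p A n c \<le> w n c" if "A \<in> sets M" for A n c
  proof -
    show "refining (?p A)" by (rule refining_measure_cell[OF \<mu> h U that])
    show "?p A n c \<le> w n c"
      unfolding w_def using sets.sets_into_space[OF that] HG(1)[of n c] \<mu>(2)
      by (intro \<mu>.finite_measure_mono) auto
  qed
  have q: "refining (?q B)" "?q B n c \<le> w n c" if "B \<in> sets N" for B n c
  proof -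
    show "refining (?q B)" by (rule refining_measure_cell[OF \<nu> g U that])
    show "?q B n c \<le> w n c"
      unfolding w[symmetric] using sets.sets_into_space[OF that] HG(2)[of n c] \<nu>(2)
      by (intro \<nu>.finite_measure_mono) auto
  qed
  have refw: "refining w"
    using p(1)[OF sets.top] by (simp add: w_def[abs_def])
  have w0: "0 \<le> w n c" for n c by (simp add: w_def)
  have lim: "(\<lambda>n. cell_coupling U h g \<mu> \<nu> n A B) \<longlonglongrightarrow> lim (\<lambda>n. cell_coupling U h g \<mu> \<nu> n A B)"
    if "A \<in> sets M" "B \<in> sets N" for A B
    unfolding convergent_LIMSEQ_iff[symmetric] cc
    by (rule refining_product_convergent) (use p[OF that(1)] q[OF that(2)] refw in auto)
  have marg: "cell_coupling U h g \<mu> \<nu> n A (space N) = measure \<mu> A" if "A \<in> sets M" for n A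
  proof -
    have "cell_coupling U h g \<mu> \<nu> n A (space N) = (\<Sum>c\<in>Pow {..<n}. ?p A n c)"
      unfolding cc
    proof (rule sum.cong[OF refl])
      \<comment> \<open>For the whole space \<open>?q\<close> equals \<open>w\<close> and cancels;
        if \<open>w n c = 0\<close>, then \<open>?p\<close> is bounded by 0 and both sides
        vanish.\<close>
      fix c show "?p A n c * ?q (space N) n c / w n c = ?p A n c"
        using p(2)[OF that, of n c] by (cases "w n c = 0") (auto simp: w measure_le_0_iff)
    qed
    also have "\<dots> = measure \<mu> A" by (simp add: refining_sum[OF p(1)[OF that]])
    finally show ?thesis .
  qed
  have marg': "cell_coupling U h g \<mu> \<nu> n (space M) B = measure \<nu> B" if "B \<in> sets N" for n B
  proof -
    have "cell_coupling U h g \<mu> \<nu> n (space M) B = (\<Sum>c\<in>Pow {..<n}. ?q B n c)"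
      unfolding cc
    proof (rule sum.cong[OF refl])
      fix c show "?p (space M) n c * ?q B n c / w n c = ?q B n c"
        using q(2)[OF that, of n c] by (cases "w n c = 0") (auto simp: w_def measure_le_0_iff)
    qed
    also have "\<dots> = measure \<nu> B" by (simp add: refining_sum[OF q(1)[OF that]])
    finally show ?thesis .
  qed
  have spair: "sets (\<mu> \<Otimes>\<^sub>M \<nu>) = sets (M \<Otimes>\<^sub>M N)" by (rule sets_pair_measure_cong[OF \<mu>(2) \<nu>(2)])
  \<comment> \<open>The density of the level-\<open>n\<close> coupling. Cells of mass 0 get weight
    \<open>1 / 0 = 0\<close>.\<close>
  define f where "f n z = (\<Sum>c\<in>Pow {..<n}. ennreal (1 / w n c) * indicator (?H n c \<times> ?G n c) z)" for n and z :: "'a \<times> 'b"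
  have HGpair: "?H n c \<times> ?G n c \<in> sets (\<mu> \<Otimes>\<^sub>M \<nu>)" for n c
    unfolding spair using HG by simp
  have fm: "f n \<in> borel_measurable (\<mu> \<Otimes>\<^sub>M \<nu>)" for n
    unfolding f_def by (intro borel_measurable_sum borel_measurable_times_ennreal borel_measurable_const borel_measurable_indicator HGpair)
  define m where "m n = density (\<mu> \<Otimes>\<^sub>M \<nu>) (f n)" for n
  have em: "emeasure (m n) (A \<times> B) = ennreal (cell_coupling U h g \<mu> \<nu> n A B)"
    if AB: "A \<in> sets M" "B \<in> sets N" for n A B
  proof -
    have AB': "A \<times> B \<in> sets (\<mu> \<Otimes>\<^sub>M \<nu>)" unfolding spair using AB by simp
    have "emeasure (m n) (A \<times> B) = (\<integral>\<^sup>+z. f n z * indicator (A \<times> B) z \<partial>(\<mu> \<Otimes>\<^sub>M \<nu>))"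
      unfolding m_def using fm AB' by (rule emeasure_density)
    also have "\<dots> = (\<integral>\<^sup>+z. (\<Sum>c\<in>Pow {..<n}. ennreal (1 / w n c) * indicator ((?H n c \<times> ?G n c) \<inter> (A \<times> B)) z) \<partial>(\<mu> \<Otimes>\<^sub>M \<nu>))"
      unfolding f_def sum_distrib_right indicator_inter_arith by (simp only: mult.assoc)
    also have "\<dots> = (\<Sum>c\<in>Pow {..<n}. \<integral>\<^sup>+z. ennreal (1 / w n c) * indicator ((?H n c \<times> ?G n c) \<inter> (A \<times> B)) z \<partial>(\<mu> \<Otimes>\<^sub>M \<nu>))"
      by (intro nn_integral_sum borel_measurable_times_ennreal borel_measurable_const borel_measurable_indicator sets.Int HGpair AB')
    also have "\<dots> = (\<Sum>c\<in>Pow {..<n}. ennreal (?p A n c * ?q B n c / w n c))"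
    proof (rule sum.cong[OF refl])
      fix c
      have pq: "A \<inter> h -` cell U n c = ?H n c \<inter> A" "B \<inter> g -` cell U n c = ?G n c \<inter> B"
        using AB[THEN sets.sets_into_space] by auto
      have "(\<integral>\<^sup>+z. ennreal (1 / w n c) * indicator ((?H n c \<times> ?G n c) \<inter> (A \<times> B)) z \<partial>(\<mu> \<Otimes>\<^sub>M \<nu>))
          = ennreal (1 / w n c) * emeasure (\<mu> \<Otimes>\<^sub>M \<nu>) ((?H n c \<times> ?G n c) \<inter> (A \<times> B))"
        by (intro nn_integral_cmult_indicator sets.Int HGpair AB')
      also have "emeasure (\<mu> \<Otimes>\<^sub>M \<nu>) ((?H n c \<times> ?G n c) \<inter> (A \<times> B)) = emeasure \<mu> (?H n c \<inter> A) * emeasure \<nu> (?G n c \<inter> B)"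
        unfolding Times_Int_Times using HG AB \<mu>(2) \<nu>(2) by (intro \<nu>.emeasure_pair_measure_Times) auto
      also have "ennreal (1 / w n c) * (emeasure \<mu> (?H n c \<inter> A) * emeasure \<nu> (?G n c \<inter> B)) = ennreal (?p A n c * ?q B n c / w n c)"
        unfolding \<mu>.emeasure_eq_measure \<nu>.emeasure_eq_measure pq by (simp add: w0 flip: ennreal_mult)
      finally show "(\<integral>\<^sup>+z. ennreal (1 / w n c) * indicator ((?H n c \<times> ?G n c) \<inter> (A \<times> B)) z \<partial>(\<mu> \<Otimes>\<^sub>M \<nu>))
          = ennreal (?p A n c * ?q B n c / w n c)" .
    qed
    also have "\<dots> = ennreal (cell_coupling U h g \<mu> \<nu> n A B)"
      unfolding cc by (rule sum_ennreal) (simp add: w0)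
    finally show ?thesis .
  qed
  have cc0: "0 \<le> cell_coupling U h g \<mu> \<nu> n A B" for n A B
    unfolding cc by (intro sum_nonneg) (simp add: w0)
  have mm: "measure (m n) (A \<times> B) = cell_coupling U h g \<mu> \<nu> n A B" if "A \<in> sets M" "B \<in> sets N" for n A B
    unfolding measure_def em[OF that] by (simp add: cc0)
  have "finite_measure (m n)" for n
  proof
    have "space (m n) = space M \<times> space N" by (simp add: m_def space_pair_measure sp)
    then show "emeasure (m n) (space (m n)) \<noteq> \<infinity>" by (simp add: em)
  qed
  moreover have "sets (m n) = sets (M \<Otimes>\<^sub>M N)" for n by (simp add: m_def spair)
  moreover have "measure (m n) (A \<times> space N) = measure \<mu> A" if "A \<in> sets M" for n A
    using that marg by (simp add: mm)
  moreover have "measure (m n) (space M \<times> B) = measure \<nu> B" if "B \<in> sets N" for n B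
    using that marg' by (simp add: mm)
  moreover have "(\<lambda>n. measure (m n) (A \<times> B)) \<longlonglongrightarrow> lim (\<lambda>n. cell_coupling U h g \<mu> \<nu> n A B)"
    if "A \<in> sets M" "B \<in> sets N" for A B
    unfolding mm[OF that] by (rule lim[OF that])
  ultimately have "\<exists>\<rho>. sets \<rho> = sets (M \<Otimes>\<^sub>M N) \<and>
    (\<forall>A\<in>sets M. \<forall>B\<in>sets N. emeasure \<rho> (A \<times> B) = ennreal (lim (\<lambda>n. cell_coupling U h g \<mu> \<nu> n A B)))"
    by (rule bimeasure_extension[OF i j \<mu> \<nu>])
  then obtain \<rho> where \<rho>: "sets \<rho> = sets (M \<Otimes>\<^sub>M N)"
    "\<And>A B. A \<in> sets M \<Longrightarrow> B \<in> sets N \<Longrightarrow> emeasure \<rho> (A \<times> B) = ennreal (lim (\<lambda>n. cell_coupling U h g \<mu> \<nu> n A B))"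
    by blast
  have null: "A \<times> B \<in> null_sets \<rho>" if AB: "A \<in> sets M" "B \<in> sets N"
    and k: "A \<times> B \<subseteq> {(a, b). (h a \<in> U k) \<noteq> (g b \<in> U k)}" for A B k
  proof -
    \<comment> \<open>From level \<open>k + 1\<close> on, each cell lies inside \<open>U k\<close>
      or outside it. Points of \<open>A\<close> and \<open>B\<close> never lie over the same cell,
      so each summand has an empty factor.\<close>
    have "cell_coupling U h g \<mu> \<nu> n A B = 0" if "k < n" for n
      unfolding cc
    proof (rule sum.neutral, rule ballI)
      fix c
      have "A \<inter> h -` cell U n c = {} \<or> B \<inter> g -` cell U n c = {}"
        using k that by (fastforce simp: cell_def)
      then show "?p A n c * ?q B n c / w n c = 0" by auto
    qed
    then have "eventually (\<lambda>n. cell_coupling U h g \<mu> \<nu> n A B = 0) sequentially"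
      by (intro eventually_sequentiallyI[of "Suc k"]) simp
    then have "lim (\<lambda>n. cell_coupling U h g \<mu> \<nu> n A B) = 0"
      by (intro limI tendsto_eventually)
    then show ?thesis using \<rho> AB by (intro null_setsI) auto
  qed
  have hU: "h -` U k \<inter> space M \<in> sets M" "g -` U k \<inter> space N \<in> sets N" for k
    using h g U by (auto intro: measurable_sets)
  have hU': "space M - h -` U k \<in> sets M" "space N - g -` U k \<in> sets N" for k
    using sets.compl_sets[OF hU(1)[of k]] sets.compl_sets[OF hU(2)[of k]] by (simp_all add: Diff_Int_distrib Diff_Int)
  show ?thesis
  proof (rule that[OF \<rho>])
    show "emeasure \<rho> (A \<times> space N) = emeasure \<mu> A" if "A \<in> sets M" for A
      using \<rho>(2)[OF that sets.top] that marg by (simp add: \<mu>.emeasure_eq_measure)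
    show "emeasure \<rho> (space M \<times> B) = emeasure \<nu> B" if "B \<in> sets N" for B
      using \<rho>(2)[OF sets.top that] that marg' by (simp add: \<nu>.emeasure_eq_measure)
    show "(h -` U k \<inter> space M) \<times> (space N - g -` U k) \<in> null_sets \<rho>"
      "(space M - h -` U k) \<times> (g -` U k \<inter> space N) \<in> null_sets \<rho>" for k
      by (rule null[OF hU(1) hU'(2), of k k], blast) (rule null[OF hU'(1) hU(2), of k k], blast)
  qed
qed

section \<open>The semipullback\<close>

text \<open>The sets are the preimages of a countable base: distinct points have distinct images,
  and some basic open set contains the first image and avoids the second. They generate the
  partitions of the base space.\<close>

lemma um_embedding_separating:
  fixes i :: "'a \<Rightarrow> 'x::{second_countable_topology,complete_space}"
  assumes i: "um_embedding M i"
  obtains U :: "nat \<Rightarrow> 'a set" where "\<And>k. U k \<in> sets M"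
    "\<And>x y. x \<in> space M \<Longrightarrow> y \<in> space M \<Longrightarrow> (\<And>k. x \<in> U k \<longleftrightarrow> y \<in> U k) \<Longrightarrow> x = y"
proof -
  obtain \<B> :: "'x set set" where \<B>: "countable \<B>" "topological_basis \<B>"
    using ex_countable_basis by blast
  define U where "U k = i -` (from_nat_into \<B> k) \<inter> space M" for k
  show ?thesis
  proof
    have ne: "\<B> \<noteq> {}" using topological_basisE[OF \<B>(2) open_UNIV UNIV_I] by blast
    show "U k \<in> sets M" for k
    proof -
      have "open (from_nat_into \<B> k)"
        using topological_basis_open[OF \<B>(2) from_nat_into[OF ne]] .
      then show ?thesis
        using i by (auto simp: U_def um_embedding_def intro: measurable_sets borel_open)
    qed
    fix x y assume xy: "x \<in> space M" "y \<in> space M" and eq: "\<And>k. x \<in> U k \<longleftrightarrow> y \<in> U k"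
    show "x = y"
    proof (rule ccontr)
      assume "x \<noteq> y"
      then have "i x \<noteq> i y" using i xy by (auto simp: um_embedding_def dest: inj_onD)
      then have "open (- {i y})" "i x \<in> - {i y}" by auto
      then obtain B where B: "B \<in> \<B>" "i x \<in> B" "B \<subseteq> - {i y}"
        using topological_basisE[OF \<B>(2)] by metis
      obtain k where "from_nat_into \<B> k = B" using from_nat_into_surj[OF \<B>(1) B(1)] by blast
      then have "x \<in> U k" "y \<notin> U k" using B xy by (auto simp: U_def)
      then show False using eq by blast
    qed
  qed
qed

lemma is_lmpD:
  assumes "is_lmp L S" "a \<in> L" "s \<in> space (states S)"
  shows "subprob_space (kernel S a s)" "finite_measure (kernel S a s)" "sets (kernel S a s) = sets (states S)"
proof -
  have "kernel S a s \<in> space (subprob_algebra (states S))"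
    using assms by (intro measurable_space[of "kernel S a" "states S"]) (auto simp: is_lmp_def)
  then show "subprob_space (kernel S a s)" "sets (kernel S a s) = sets (states S)"
    by (simp_all add: space_subprob_algebra)
  then show "finite_measure (kernel S a s)" by (simp add: subprob_space.axioms)
qed

text \<open>For fixed \<open>n\<close>, \<open>A\<close> and \<open>B\<close> this is a finite sum
  of products and quotients of kernel values. It is what makes the limit, hence the constructed
  kernel on rectangles, depend measurably on the pair of states.\<close>

lemma measurable_cell_coupling:
  assumes K: "K \<in> M \<rightarrow>\<^sub>M subprob_algebra M" and K': "K' \<in> N \<rightarrow>\<^sub>M subprob_algebra N"
    and h: "h \<in> M \<rightarrow>\<^sub>M S" and g: "g \<in> N \<rightarrow>\<^sub>M S" and U: "\<And>k. U k \<in> sets S"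
    and A: "A \<in> sets M" and B: "B \<in> sets N"
  shows "(\<lambda>z. cell_coupling U h g (K (fst z)) (K' (snd z)) n A B) \<in> borel_measurable (M \<Otimes>\<^sub>M N)"
proof -
  have sp: "space (K s) = space M" if "s \<in> space M" for s
    using subprob_measurableD(1)[OF K that] .
  have s: "C \<inter> h -` cell U n c \<in> sets M" if "C \<in> sets M" for C c
  proof -
    have "C \<inter> h -` cell U n c = C \<inter> (h -` cell U n c \<inter> space M)" using sets.sets_into_space[OF that] by auto
    then show ?thesis using that sets_vimage_cell[OF h U] by simp
  qed
  have s': "C \<inter> g -` cell U n c \<in> sets N" if "C \<in> sets N" for C c
  proof -
    have "C \<inter> g -` cell U n c = C \<inter> (g -` cell U n c \<inter> space N)" using sets.sets_into_space[OF that] by auto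
    then show ?thesis using that sets_vimage_cell[OF g U] by simp
  qed
  have m: "(\<lambda>z. measure (K (fst z)) C) \<in> borel_measurable (M \<Otimes>\<^sub>M N)" if "C \<in> sets M" for C
    using measurable_compose[OF measurable_compose[OF measurable_fst K] measurable_measure_subprob_algebra[OF that]] .
  have m': "(\<lambda>z. measure (K' (snd z)) C) \<in> borel_measurable (M \<Otimes>\<^sub>M N)" if "C \<in> sets N" for C
    using measurable_compose[OF measurable_compose[OF measurable_snd K'] measurable_measure_subprob_algebra[OF that]] .
  have "(\<lambda>z. \<Sum>c\<in>Pow {..<n}. measure (K (fst z)) (A \<inter> h -` cell U n c) * measure (K' (snd z)) (B \<inter> g -` cell U n c)
      / measure (K (fst z)) (space M \<inter> h -` cell U n c)) \<in> borel_measurable (M \<Otimes>\<^sub>M N)"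
    by (intro borel_measurable_sum borel_measurable_divide borel_measurable_times m m' s s' A B sets.top)
  moreover have "cell_coupling U h g (K (fst z)) (K' (snd z)) n A B =
      (\<Sum>c\<in>Pow {..<n}. measure (K (fst z)) (A \<inter> h -` cell U n c) * measure (K' (snd z)) (B \<inter> g -` cell U n c)
      / measure (K (fst z)) (space M \<inter> h -` cell U n c))" if "z \<in> space (M \<Otimes>\<^sub>M N)" for z
    using that by (auto simp: cell_coupling_def space_pair_measure sp)
  ultimately show ?thesis by (subst measurable_cong) auto
qed

theorem theorem5p3:
  fixes L :: "'l set"
    and S1 :: "('l, 'a) lmp" and S2 :: "('l, 'b) lmp" and S0 :: "('l, 'c) lmp"
    and h1 :: "'a \<Rightarrow> 'c" and h2 :: "'b \<Rightarrow> 'c"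
  assumes "cospan L S1 S2 S0 h1 h2"
  shows "\<exists>(S3 :: ('l, 'a \<times> 'b) lmp) k1 k2. semipullback L S1 S2 h1 h2 S3 k1 k2"
proof -
  let ?M = "states S1" and ?N = "states S2" and ?S = "states S0"
  have lmp: "is_lmp L S1" "is_lmp L S2" "is_lmp L S0"
    and um: "separable_universally_measurable ?M" "separable_universally_measurable ?N" "separable_universally_measurable ?S"
    and zz: "zigzag L S1 S0 h1" "zigzag L S2 S0 h2"
    using assms by (auto simp: cospan_def separable_um_lmp_def)
  have h: "h1 \<in> ?M \<rightarrow>\<^sub>M ?S" and g: "h2 \<in> ?N \<rightarrow>\<^sub>M ?S"
    and surj: "h1 ` space ?M = space ?S" "h2 ` space ?N = space ?S"
    using zz by (auto simp: zigzag_def)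
  obtain i1 :: "'a \<Rightarrow> nat \<Rightarrow> real" where i1: "um_embedding ?M i1" using um(1) by (rule separable_imp_um_embedding)
  obtain i2 :: "'b \<Rightarrow> nat \<Rightarrow> real" where i2: "um_embedding ?N i2" using um(2) by (rule separable_imp_um_embedding)
  obtain i0 :: "'c \<Rightarrow> nat \<Rightarrow> real" where i0: "um_embedding ?S i0" using um(3) by (rule separable_imp_um_embedding)
  obtain U :: "nat \<Rightarrow> 'c set" where U: "\<And>k. U k \<in> sets ?S"
    and sep: "\<And>x y. x \<in> space ?S \<Longrightarrow> y \<in> space ?S \<Longrightarrow> (\<And>k. x \<in> U k \<longleftrightarrow> y \<in> U k) \<Longrightarrow> x = y"
    using um_embedding_separating[OF i0] by metis

  \<comment> \<open>The pullback as a measurable set\<close>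
  define D where "D = {z \<in> space (?M \<Otimes>\<^sub>M ?N). h1 (fst z) = h2 (snd z)}"
  define E where "E k = (h1 -` U k \<inter> space ?M) \<times> (space ?N - h2 -` U k) \<union>
    (space ?M - h1 -` U k) \<times> (h2 -` U k \<inter> space ?N)" for k
  \<comment> \<open>As the \<open>U k\<close> separate the points of the base, a pair is off the
    pullback exactly when some \<open>U k\<close> tells its two images apart. The complement is thus
    a countable union of measurable rectangles, which gives both the measurability of
    \<open>D\<close> and its full measure under the couplings.\<close>
  have compl: "space (?M \<Otimes>\<^sub>M ?N) - D = (\<Union>k. E k)"
  proof (rule set_eqI)
    fix z :: "'a \<times> 'b"
    obtain a b where z: "z = (a, b)" by (cases z)
    have "h1 a = h2 b \<longleftrightarrow> (\<forall>k. h1 a \<in> U k \<longleftrightarrow> h2 b \<in> U k)" if "a \<in> space ?M" "b \<in> space ?N"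
      using sep[OF measurable_space[OF h that(1)] measurable_space[OF g that(2)]] by auto
    then show "z \<in> space (?M \<Otimes>\<^sub>M ?N) - D \<longleftrightarrow> z \<in> (\<Union>k. E k)"
      by (auto simp: z D_def E_def space_pair_measure)
  qed
  have hU: "h1 -` U k \<inter> space ?M \<in> sets ?M" "h2 -` U k \<inter> space ?N \<in> sets ?N" for k
    using h g U by (auto intro: measurable_sets)
  have hU': "space ?M - h1 -` U k \<in> sets ?M" "space ?N - h2 -` U k \<in> sets ?N" for k
    using sets.compl_sets[OF hU(1)[of k]] sets.compl_sets[OF hU(2)[of k]]
    by (simp_all add: Diff_Int)
  have "E k \<in> sets (?M \<Otimes>\<^sub>M ?N)" for k
    unfolding E_def by (intro sets.Un pair_measureI hU hU')
  then have "space (?M \<Otimes>\<^sub>M ?N) - (\<Union>k. E k) \<in> sets (?M \<Otimes>\<^sub>M ?N)"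
    by (intro sets.compl_sets sets.countable_UN) auto
  moreover have DS: "D \<subseteq> space (?M \<Otimes>\<^sub>M ?N)" by (auto simp: D_def)
  ultimately have D: "D \<in> sets (?M \<Otimes>\<^sub>M ?N)"
    using compl by (metis double_diff order_refl)

  \<comment> \<open>The coupling kernel over the pullback\<close>
  define good where "good a z \<rho> \<longleftrightarrow> sets \<rho> = sets (?M \<Otimes>\<^sub>M ?N) \<and>
      (\<forall>A\<in>sets ?M. \<forall>B\<in>sets ?N. emeasure \<rho> (A \<times> B) =
         ennreal (lim (\<lambda>n. cell_coupling U h1 h2 (kernel S1 a (fst z)) (kernel S2 a (snd z)) n A B))) \<and>
      (\<forall>A\<in>sets ?M. emeasure \<rho> (A \<times> space ?N) = emeasure (kernel S1 a (fst z)) A) \<and>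
      (\<forall>B\<in>sets ?N. emeasure \<rho> (space ?M \<times> B) = emeasure (kernel S2 a (snd z)) B) \<and>
      space (?M \<Otimes>\<^sub>M ?N) - D \<in> null_sets \<rho>" for a z \<rho>
  have ex: "\<exists>\<rho>. good a z \<rho>" if a: "a \<in> L" and z: "z \<in> D" for a z
  proof -
    have z': "fst z \<in> space ?M" "snd z \<in> space ?N" and hz: "h1 (fst z) = h2 (snd z)"
      using z by (auto simp: D_def space_pair_measure)
    note fin = is_lmpD(2,3)[OF lmp(1) a z'(1)] is_lmpD(2,3)[OF lmp(2) a z'(2)]
    \<comment> \<open>By the zigzag property both sides equal the mass of \<open>Q\<close> under the
      kernel of \<open>S0\<close> at the common image
      \<open>h1 (fst z) = h2 (snd z)\<close>.\<close>
    have eq: "measure (kernel S1 a (fst z)) (h1 -` Q \<inter> space ?M) = measure (kernel S2 a (snd z)) (h2 -` Q \<inter> space ?N)"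
      if "Q \<in> sets ?S" for Q
      using zz a z' hz that by (simp add: zigzag_def measure_def)
    show ?thesis
    proof (rule coupling_exists[OF i1 i2 fin h g, of U])
      show "U k \<in> sets ?S" for k by (rule U)
      show "measure (kernel S1 a (fst z)) (h1 -` Q \<inter> space ?M) = measure (kernel S2 a (snd z)) (h2 -` Q \<inter> space ?N)"
        if "Q \<in> sets ?S" for Q using that by (rule eq)
      fix \<rho> assume \<rho>: "sets \<rho> = sets (?M \<Otimes>\<^sub>M ?N)"
        "\<And>A B. A \<in> sets ?M \<Longrightarrow> B \<in> sets ?N \<Longrightarrow> emeasure \<rho> (A \<times> B) =
           ennreal (lim (\<lambda>n. cell_coupling U h1 h2 (kernel S1 a (fst z)) (kernel S2 a (snd z)) n A B))"
        "\<And>A. A \<in> sets ?M \<Longrightarrow> emeasure \<rho> (A \<times> space ?N) = emeasure (kernel S1 a (fst z)) A"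
        "\<And>B. B \<in> sets ?N \<Longrightarrow> emeasure \<rho> (space ?M \<times> B) = emeasure (kernel S2 a (snd z)) B"
        "\<And>k. (h1 -` U k \<inter> space ?M) \<times> (space ?N - h2 -` U k) \<in> null_sets \<rho>"
        "\<And>k. (space ?M - h1 -` U k) \<times> (h2 -` U k \<inter> space ?N) \<in> null_sets \<rho>"
      have "(\<Union>k. E k) \<in> null_sets \<rho>"
        unfolding E_def by (intro null_sets_UN null_sets.Un \<rho>(5,6))
      then have "good a z \<rho>"
        unfolding good_def compl using \<rho>(1-4) by blast
      then show ?thesis by blast
    qed
  qed
  \<comment> \<open>The pointwise choice does not endanger measurability in \<open>z\<close>:
    \<open>good\<close> prescribes the values on all rectangles by an explicit limit.\<close>
  define \<kappa> where "\<kappa> a z = (SOME \<rho>. good a z \<rho>)" for a z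
  have good: "good a z (\<kappa> a z)" if "a \<in> L" "z \<in> D" for a z
    unfolding \<kappa>_def using ex[OF that] by (rule someI_ex)
  have \<kappa>_fst: "emeasure (\<kappa> a z) (A \<times> space ?N) = emeasure (kernel S1 a (fst z)) A"
    if "a \<in> L" "z \<in> D" "A \<in> sets ?M" for a z A
    using good[OF that(1,2)] that(3) unfolding good_def by blast
  have \<kappa>_snd: "emeasure (\<kappa> a z) (space ?M \<times> B) = emeasure (kernel S2 a (snd z)) B"
    if "a \<in> L" "z \<in> D" "B \<in> sets ?N" for a z B
    using good[OF that(1,2)] that(3) unfolding good_def by blast
  have \<kappa>_space: "space (\<kappa> a z) = space (?M \<Otimes>\<^sub>M ?N)" if "a \<in> L" "z \<in> D" for a z
    using good[OF that] sets_eq_imp_space_eq unfolding good_def by blast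
  define S3 :: "('l, 'a \<times> 'b) lmp" where
    "S3 = \<lparr>states = restrict_space (?M \<Otimes>\<^sub>M ?N) D, kernel = (\<lambda>a z. restrict_space (\<kappa> a z) D)\<rparr>"
  have sp3: "space (states S3) = D"
    using DS by (auto simp: S3_def space_restrict_space)
  have D_iff: "z \<in> D \<longleftrightarrow> fst z \<in> space ?M \<and> snd z \<in> space ?N \<and> h1 (fst z) = h2 (snd z)" for z
    by (cases z) (auto simp: D_def space_pair_measure)
  \<comment> \<open>Restriction to \<open>D\<close> loses no mass, because the complement of
    \<open>D\<close> is a null set.\<close>
  have kernel3: "emeasure (kernel S3 a z) (X \<inter> D) = emeasure (\<kappa> a z) X"
    if az: "a \<in> L" "z \<in> D" and X: "X \<in> sets (?M \<Otimes>\<^sub>M ?N)" for a z X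
  proof -
    have s: "sets (\<kappa> a z) = sets (?M \<Otimes>\<^sub>M ?N)" and null: "space (?M \<Otimes>\<^sub>M ?N) - D \<in> null_sets (\<kappa> a z)"
      using good[OF az] by (auto simp: good_def)
    have "emeasure (kernel S3 a z) (X \<inter> D) = emeasure (\<kappa> a z) (X \<inter> D)"
      unfolding S3_def using D DS s \<kappa>_space[OF az] by (simp add: emeasure_restrict_space Int_absorb2)
    also have "\<dots> = emeasure (\<kappa> a z) (X - (space (?M \<Otimes>\<^sub>M ?N) - D))"
      using sets.sets_into_space[OF X] by (intro arg_cong[where f = "emeasure (\<kappa> a z)"]) auto
    also have "\<dots> = emeasure (\<kappa> a z) X"
      using null X s by (intro emeasure_Diff_null_set) auto
    finally show ?thesis .
  qed

  \<comment> \<open>The process on the pullback\<close>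
  have "is_lmp L S3"
    unfolding is_lmp_def
  proof
    fix a assume a: "a \<in> L"
    show "kernel S3 a \<in> states S3 \<rightarrow>\<^sub>M subprob_algebra (states S3)"
    \<comment> \<open>An empty pullback makes measurability of the kernel vacuous; it is treated
      apart because subprobability measures live on nonempty spaces.\<close>
    proof (cases "D = {}")
      case True
      then show ?thesis using sp3 by (simp add: measurable_def)
    next
      case False
      \<comment> \<open>Measurability is checked on rectangles only, an intersection-stable
        generator; total mass at most 1 is read off from the first marginal.\<close>
      have "\<kappa> a \<in> states S3 \<rightarrow>\<^sub>M subprob_algebra (?M \<Otimes>\<^sub>M ?N)"
      proof (rule measurable_subprob_algebra_generated[OF sets_pair_measure Int_stable_pair_measure_generator pair_measure_closed], unfold sp3)
        fix z assume z: "z \<in> D"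
        show "sets (\<kappa> a z) = sets (?M \<Otimes>\<^sub>M ?N)" using good[OF a z] by (simp add: good_def)
        show "subprob_space (\<kappa> a z)"
        proof
          show "space (\<kappa> a z) \<noteq> {}" using z DS \<kappa>_space[OF a z] by auto
          have "emeasure (\<kappa> a z) (space (\<kappa> a z)) = emeasure (kernel S1 a (fst z)) (space ?M)"
            unfolding \<kappa>_space[OF a z] space_pair_measure by (rule \<kappa>_fst[OF a z sets.top])
          also have "\<dots> \<le> 1"
            using is_lmpD(1)[OF lmp(1) a, of "fst z"] z by (simp add: D_iff subprob_space.subprob_emeasure_le_1)
          finally show "emeasure (\<kappa> a z) (space (\<kappa> a z)) \<le> 1" .
        qed
      next
        have meas: "(\<lambda>z. emeasure (\<kappa> a z) (A \<times> B)) \<in> borel_measurable (states S3)"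
          if AB: "A \<in> sets ?M" "B \<in> sets ?N" for A B
        proof -
          have K: "kernel S1 a \<in> ?M \<rightarrow>\<^sub>M subprob_algebra ?M" "kernel S2 a \<in> ?N \<rightarrow>\<^sub>M subprob_algebra ?N"
            using lmp a by (auto simp: is_lmp_def)
          have "(\<lambda>z. cell_coupling U h1 h2 (kernel S1 a (fst z)) (kernel S2 a (snd z)) n A B) \<in> borel_measurable (states S3)" for n
            unfolding S3_def lmp.simps
            by (intro measurable_restrict_space1 measurable_cell_coupling[OF K h g U AB])
          then have "(\<lambda>z. ennreal (lim (\<lambda>n. cell_coupling U h1 h2 (kernel S1 a (fst z)) (kernel S2 a (snd z)) n A B)))
              \<in> borel_measurable (states S3)"
            by (rule measurable_compose[OF borel_measurable_lim_metric measurable_ennreal])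
          then show ?thesis
            by (subst measurable_cong) (use good[OF a] AB in \<open>auto simp: sp3 good_def\<close>)
        qed
        show "(\<lambda>z. emeasure (\<kappa> a z) X) \<in> borel_measurable (states S3)"
          if "X \<in> {A \<times> B |A B. A \<in> sets ?M \<and> B \<in> sets ?N}" for X
          using that meas by blast
        show "(\<lambda>z. emeasure (\<kappa> a z) (space ?M \<times> space ?N)) \<in> borel_measurable (states S3)"
          by (intro meas sets.top)
      qed
      from restrict_space_measurable[OF False D this]
      show ?thesis by (simp add: S3_def)
    qed
  qed
  moreover have "separable_universally_measurable (states S3)"
    unfolding S3_def lmp.simps by (rule um_embedding_imp_separable[OF um_embedding_pair[OF i1 i2 D]])

  \<comment> \<open>The projections as zigzag morphisms\<close>
  moreover have "zigzag L S3 S1 fst"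
    unfolding zigzag_def
  proof (intro conjI ballI)
    show "fst \<in> states S3 \<rightarrow>\<^sub>M ?M"
      unfolding S3_def lmp.simps by (intro measurable_restrict_space1 measurable_fst)
    show "fst ` space (states S3) = space ?M"
    proof
      show "space ?M \<subseteq> fst ` space (states S3)"
      proof
        fix s assume s: "s \<in> space ?M"
        \<comment> \<open>Surjectivity of \<open>h2\<close> supplies a partner for \<open>s\<close>,
          so the projection from \<open>D\<close> is onto.\<close>
        then obtain t where "t \<in> space ?N" "h1 s = h2 t" using surj by (metis imageE imageI)
        then have "(s, t) \<in> D" using s by (simp add: D_iff)
        then show "s \<in> fst ` space (states S3)" unfolding sp3 by force
      qed
    qed (auto simp: sp3 D_iff)
    fix a z Q assume a: "a \<in> L" and "z \<in> space (states S3)" and Q: "Q \<in> sets ?M"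
    then have z: "z \<in> D" by (simp add: sp3)
    \<comment> \<open>On \<open>D\<close> the preimage of \<open>Q\<close> is the trace of a
      cylinder, whose \<kappa>-mass is given by the first marginal.\<close>
    have "fst -` Q \<inter> D = (Q \<times> space ?N) \<inter> D" by (auto simp: D_iff)
    then show "emeasure (kernel S3 a z) (fst -` Q \<inter> space (states S3)) = emeasure (kernel S1 a (fst z)) Q"
      using kernel3[OF a z, of "Q \<times> space ?N"] \<kappa>_fst[OF a z Q] Q by (simp add: sp3)
  qed
  moreover have "zigzag L S3 S2 snd"
    unfolding zigzag_def
  proof (intro conjI ballI)
    show "snd \<in> states S3 \<rightarrow>\<^sub>M ?N"
      unfolding S3_def lmp.simps by (intro measurable_restrict_space1 measurable_snd)
    show "snd ` space (states S3) = space ?N"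
    proof
      show "space ?N \<subseteq> snd ` space (states S3)"
      proof
        fix t assume t: "t \<in> space ?N"
        then obtain s where "s \<in> space ?M" "h1 s = h2 t" using surj by (metis imageE imageI)
        then have "(s, t) \<in> D" using t by (simp add: D_iff)
        then show "t \<in> snd ` space (states S3)" unfolding sp3 by force
      qed
    qed (auto simp: sp3 D_iff)
    fix a z Q assume a: "a \<in> L" and "z \<in> space (states S3)" and Q: "Q \<in> sets ?N"
    then have z: "z \<in> D" by (simp add: sp3)
    have "snd -` Q \<inter> D = (space ?M \<times> Q) \<inter> D" by (auto simp: D_iff)
    then show "emeasure (kernel S3 a z) (snd -` Q \<inter> space (states S3)) = emeasure (kernel S2 a (snd z)) Q"
      using kernel3[OF a z, of "space ?M \<times> Q"] \<kappa>_snd[OF a z Q] Q by (simp add: sp3)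
  qed
  moreover have "\<forall>z\<in>space (states S3). h1 (fst z) = h2 (snd z)"
    by (simp add: sp3 D_iff)
  ultimately have "semipullback L S1 S2 h1 h2 S3 fst snd"
    by (simp add: semipullback_def separable_um_lmp_def)
  then show ?thesis by blast
qed

end
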